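(* Let $3\le l<r$ and $1\le t\le l-2$ be integers with $(t+1)\mid r$, and consider semi-global decoding of an $(l,r,t)$ SC-LDPCL protograph over a sub-block varying BEC with i.i.d. channel parameters distributed as $E\in[0,1]$. Let $$P_L=\Pr(E<\epsilon^*(\underline1,\underline1)),\quad P_S=\Pr(E<\epsilon^*(\underline1,\underline0)),\quad P_D=\Pr(E<\epsilon^*(\underline0,\underline0)).$$ Then for every even $j\ge2$ and all $\underline\delta_1,\underline\delta_2\in[0,1]^t$, $$p_j(\underline1,\underline1)\ \ge\ P_L^2\,p_{j-2}(\underline0,\underline0)+2P_L(1-P_L)\,p_{j-2}(\underline1,\underline0)+(1-P_L)^2\,p_{j-2}(\underline1,\underline1),$$ and $$\begin{aligned}p_j(\underline\delta_1,\underline\delta_2)\ \ge\ &P_L\bigl(1-\hat p_{\frac j2-1}(\underline\delta_1)\bigr)\bigl(1-\hat p_{\frac j2-1}(\underline\delta_2)\bigr)\\&+P_S\Bigl(\hat p_{\frac j2-1}(\underline\delta_2)\bigl(1-\hat p_{\frac j2-1}(\underline\delta_1)\bigr)+\hat p_{\frac j2-1}(\underline\delta_1)\bigl(1-\hat p_{\frac j2-1}(\underline\delta_2)\bigr)\Bigr)\\&+P_D\,\hat p_{\frac j2-1}(\underline\delta_1)\,\hat p_{\frac j2-1}(\underline\delta_2).\end{aligned}$$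
   Context: Empty products equal $1$; $\underline 1=(1,\dots,1)$, $\underline0=(0,\dots,0)$ in $[0,1]^t$. Put $w=r/(t+1)$, $s_{k,t}=t+1+\frac{(k-1)(k-2)}2$, $v_{k,t}=2t+1+\frac{t(t-1)}2+\frac{(k-1)(2t-k)}2$. Semi-global density evolution. For $\epsilon\in[0,1]$, $\underline\delta_L,\underline\delta_R\in[0,1]^t$ define sequences $x^{(j)}_\ell,u^{(j)}_\ell$ for labels $j\in\{1,\dots,(t+1)^2\}$ by $x_0^{(j)}=1$ and for $\ell\ge1$: for $1\le k\le t+1$: $x_\ell^{(k)}=\epsilon(u_\ell^{(k)})^{l-t-1}\prod_{j=1}^{k-1}u_\ell^{(s_{k,t}+j)}\prod_{j=k}^{t}u_\ell^{(v_{k,t}+j)}$; for $1\le i\le k-1$: $x_\ell^{(s_{k,t}+i)}=\epsilon(u_\ell^{(k)})^{l-t}\prod_{1\le j\le k-1,j\ne i}u_\ell^{(s_{k,t}+j)}\prod_{j=k}^{t}u_\ell^{(v_{k,t}+j)}$; for $k\le i\le t$: $x_\ell^{(v_{k,t}+i)}=\epsilon(u_\ell^{(k)})^{l-t}\prod_{j=1}^{k-1}u_\ell^{(s_{k,t}+j)}\prod_{k\le j\le t,j\ne i}u_\ell^{(v_{k,t}+j)}$; for $1\le k\le t$: $u_\ell^{(k)}=1-(1-x_{\ell-1}^{(k)})^{w-1}(1-x_{\ell-1}^{(t+1)})^{r-tw}\prod_{1\le j\le t,j\ne k}(1-x_{\ell-1}^{(j)})^{w}$; $u_\ell^{(t+1)}=1-(1-x_{\ell-1}^{(t+1)})^{r-tw-1}\prod_{j=1}^t(1-x_{\ell-1}^{(j)})^{w}$;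 for $1\le i\le t$, $i+1\le k\le t$: $u_\ell^{(s_{k,t}+i)}=1-(1-\delta_{R,i})(1-x_{\ell-1}^{(s_{k,t}+i)})^{w-1}(1-x_{\ell-1}^{(s_{t+1,t}+i)})^{r-tw}\prod_{i+1\le j\le t,j\ne k}(1-x_{\ell-1}^{(s_{j,t}+i)})^{w}$; for $1\le i\le t$: $u_\ell^{(s_{t+1,t}+i)}=1-(1-\delta_{R,i})(1-x_{\ell-1}^{(s_{t+1,t}+i)})^{r-tw-1}\prod_{j=i+1}^t(1-x_{\ell-1}^{(s_{j,t}+i)})^{w}$; for $1\le k\le i\le t$: $u_\ell^{(v_{k,t}+i)}=1-(1-\delta_{L,i})(1-x_{\ell-1}^{(v_{k,t}+i)})^{w-1}\prod_{1\le j\le i,j\ne k}(1-x_{\ell-1}^{(v_{j,t}+i)})^{w}$. These sequences are non-increasing in $\ell$ and lie in $[0,1]$; let $u^{(j)}$ be the limit of $u_\ell^{(j)}$. The erasure probability of a variable node of label $k\in\{1,\dots,t+1\}$ is $P^{(k)}=\epsilon(u^{(k)})^{l-t}\prod_{j=1}^{k-1}u^{(s_{k,t}+j)}\prod_{j=k}^{t}u^{(v_{k,t}+j)}$. Target threshold. $\epsilon^*(\underline\delta_1,\underline\delta_2)$ is the supremum of all $\epsilon\in[0,1]$ such that $P^{(k)}=0$ for all $k$ when the incoming erasure vectors to the sub-block from the left and right are $\underline\delta_1$ and $\underline\delta_2$. Ordering convention (which makes left and right mirror images of each other, as $(t+1)\mid r$): $\delta_{R,i}=\delta_{2,i}$ and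 $\delta_{L,i}=\delta_{1,t+1-i}$, i.e. coordinates of vectors coming from the left are listed in reversed order. (So $\epsilon^*$ is symmetric in its two arguments.) Helper function. $\Delta:[0,1]\times[0,1]^t\to[0,1]^t$ maps a helper sub-block's erasure probability $\epsilon$ and incoming vector $\underline\delta_I$ to its outgoing erasure vector: run the recursion with $\underline\delta_R=\underline\delta_I$, $\underline\delta_L=\underline1$, and set $\Delta(\epsilon,\underline\delta_I)_i=1-\prod_{k=1}^i\bigl(1-\epsilon(u^{(k)})^{l-t}\prod_{j=1}^{k-1}u^{(s_{k,t}+j)}\bigr)^w$, $1\le i\le t$. With the ordering convention the same $\Delta$ describes left helpers. Recursively $\Delta_1=\Delta$, $\Delta_k(\epsilon_1,\dots,\epsilon_k,\underline\delta)=\Delta_{k-1}(\epsilon_1,\dots,\epsilon_{k-1},\Delta(\epsilon_k,\underline\delta))$ for $k\ge2$, and $\Delta_0(\underline\delta)=\underline\delta$. Channel and success probabilities. In the sub-block varying BEC the sub-blocks have i.i.d. random erasure probabilities in $[0,1]$; $E_k$ denotes that of sub-block $m+k$, $m$ being the target. For even $j$, $p_j(\underline\delta_1,\underline\delta_2)$ is the asymptotic (infinite lifting parameter) probability of successfully decoding the target by semi-global decoding with $j/2$ helpers on each side (no helper being a first or last sub-block), where $\underline\delta_1$ enters sub-block $m-j/2$ from the left and $\underline\delta_2$ enters sub-block $m+j/2$ from the right; helpers are decoded sequentially from the farthest to the nearest, each passing its outgoing vector to the next. That is, $$p_j(\underline\delta_1,\underline\delta_2)=\Pr\bigl(E_0<\epsilon^*(\Delta_{j/2}(E_{-1},\dots,E_{-j/2},\underline\delta_1),\Delta_{j/2}(E_1,\dots,E_{j/2},\underline\delta_2))\bigr).$$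 For an integer $j\ge0$, $\hat p_j(\underline\delta)$ is the success probability when all $j$ helpers are on one side of the target, with $\underline\delta$ entering the farthest helper (and no information from the other side): $\hat p_j(\underline\delta)=\Pr\bigl(E_0<\epsilon^*(\underline1,\Delta_j(E_1,\dots,E_j,\underline\delta))\bigr)$. *)

theory Defs
  imports "HOL-Probability.Probability"
begin

text \<open>
  Vectors in $[0,1]^t$ are functions \<open>nat \<Rightarrow> real\<close> of which only the coordinates \<open>1..t\<close> are read.

  Labels are kept structured instead of being flattened to numbers \<open>1..(t+1)^2\<close>:
  \<^item> \<open>Inner k\<close>, for \<open>1 \<le> k \<le> t+1\<close>, is the label \<open>k\<close>;
  \<^item> \<open>RightC k i\<close>, for \<open>1 \<le> i < k \<le> t+1\<close>, is the label \<open>s_{k,t} + i\<close>, where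
    \<open>s_{k,t} = t+1 + (k-1)(k-2)/2\<close> (edges to the coupling checks shared with the right neighbour);
  \<^item> \<open>LeftC k i\<close>, for \<open>1 \<le> k \<le> i \<le> t\<close>, is the label \<open>v_{k,t} + i\<close>, where
    \<open>v_{k,t} = 2t+1 + t(t-1)/2 + (k-1)(2t-k)/2\<close> (edges to the coupling checks shared with the
    left neighbour).

  These index ranges are disjoint and exhaust \<open>1..(t+1)^2\<close>. The recursion at labels within
  the ranges only refers to labels within the ranges; values at other labels are irrelevant.
\<close>

datatype label = Inner nat | RightC nat nat | LeftC nat nat

definition edge_mult :: "nat \<Rightarrow> nat \<Rightarrow> nat" where
  "edge_mult r t = r div (t + 1)"

fun var_update :: "nat \<Rightarrow> nat \<Rightarrow> real \<Rightarrow> (label \<Rightarrow> real) \<Rightarrow> label \<Rightarrow> real" where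
  "var_update l t \<epsilon> u (Inner k) =
     \<epsilon> * u (Inner k) ^ (l - t - 1)
       * (\<Prod>j\<in>{1..<k}. u (RightC k j)) * (\<Prod>j\<in>{k..t}. u (LeftC k j))"
| "var_update l t \<epsilon> u (RightC k i) =
     \<epsilon> * u (Inner k) ^ (l - t)
       * (\<Prod>j\<in>{1..<k} - {i}. u (RightC k j)) * (\<Prod>j\<in>{k..t}. u (LeftC k j))"
| "var_update l t \<epsilon> u (LeftC k i) =
     \<epsilon> * u (Inner k) ^ (l - t)
       * (\<Prod>j\<in>{1..<k}. u (RightC k j)) * (\<Prod>j\<in>{k..t} - {i}. u (LeftC k j))"

fun check_update ::
  "nat \<Rightarrow> nat \<Rightarrow> (nat \<Rightarrow> real) \<Rightarrow> (nat \<Rightarrow> real) \<Rightarrow> (label \<Rightarrow> real) \<Rightarrow> label \<Rightarrow> real" where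
  "check_update r t \<delta>L \<delta>R x (Inner k) =
     (let w = edge_mult r t in
      if k = t + 1
      then 1 - (1 - x (Inner (t + 1))) ^ (r - t * w - 1) * (\<Prod>j\<in>{1..t}. (1 - x (Inner j)) ^ w)
      else 1 - (1 - x (Inner k)) ^ (w - 1) * (1 - x (Inner (t + 1))) ^ (r - t * w)
                 * (\<Prod>j\<in>{1..t} - {k}. (1 - x (Inner j)) ^ w))"
| "check_update r t \<delta>L \<delta>R x (RightC k i) =
     (let w = edge_mult r t in
      if k = t + 1
      then 1 - (1 - \<delta>R i) * (1 - x (RightC (t + 1) i)) ^ (r - t * w - 1)
                 * (\<Prod>j\<in>{i + 1..t}. (1 - x (RightC j i)) ^ w)
      else 1 - (1 - \<delta>R i) * (1 - x (RightC k i)) ^ (w - 1)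
                 * (1 - x (RightC (t + 1) i)) ^ (r - t * w)
                 * (\<Prod>j\<in>{i + 1..t} - {k}. (1 - x (RightC j i)) ^ w))"
| "check_update r t \<delta>L \<delta>R x (LeftC k i) =
     (let w = edge_mult r t in
      1 - (1 - \<delta>L i) * (1 - x (LeftC k i)) ^ (w - 1)
            * (\<Prod>j\<in>{1..i} - {k}. (1 - x (LeftC j i)) ^ w))"

primrec de_x ::
  "nat \<Rightarrow> nat \<Rightarrow> nat \<Rightarrow> real \<Rightarrow> (nat \<Rightarrow> real) \<Rightarrow> (nat \<Rightarrow> real) \<Rightarrow> nat \<Rightarrow> label \<Rightarrow> real" where
  "de_x l r t \<epsilon> \<delta>L \<delta>R 0 = (\<lambda>_. 1)"
| "de_x l r t \<epsilon> \<delta>L \<delta>R (Suc n) =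
     var_update l t \<epsilon> (check_update r t \<delta>L \<delta>R (de_x l r t \<epsilon> \<delta>L \<delta>R n))"

text \<open>The sequence \<open>u\<close> is meaningful for \<open>n \<ge> 1\<close> only; the value at \<open>0\<close> does not affect the limit.\<close>

definition de_u ::
  "nat \<Rightarrow> nat \<Rightarrow> nat \<Rightarrow> real \<Rightarrow> (nat \<Rightarrow> real) \<Rightarrow> (nat \<Rightarrow> real) \<Rightarrow> nat \<Rightarrow> label \<Rightarrow> real" where
  "de_u l r t \<epsilon> \<delta>L \<delta>R n = check_update r t \<delta>L \<delta>R (de_x l r t \<epsilon> \<delta>L \<delta>R (n - 1))"

definition de_u_lim ::
  "nat \<Rightarrow> nat \<Rightarrow> nat \<Rightarrow> real \<Rightarrow> (nat \<Rightarrow> real) \<Rightarrow> (nat \<Rightarrow> real) \<Rightarrow> label \<Rightarrow> real" where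
  "de_u_lim l r t \<epsilon> \<delta>L \<delta>R a = lim (\<lambda>n. de_u l r t \<epsilon> \<delta>L \<delta>R n a)"

definition erasure_prob ::
  "nat \<Rightarrow> nat \<Rightarrow> nat \<Rightarrow> real \<Rightarrow> (nat \<Rightarrow> real) \<Rightarrow> (nat \<Rightarrow> real) \<Rightarrow> nat \<Rightarrow> real" where
  "erasure_prob l r t \<epsilon> \<delta>L \<delta>R k =
     (let u = de_u_lim l r t \<epsilon> \<delta>L \<delta>R in
      \<epsilon> * u (Inner k) ^ (l - t)
        * (\<Prod>j\<in>{1..<k}. u (RightC k j)) * (\<Prod>j\<in>{k..t}. u (LeftC k j)))"

text \<open>
  The first argument vector comes from the left and is listed in reversed order, so that left and
  right sub-blocks are mirror images of each other.
\<close>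

definition eps_star :: "nat \<Rightarrow> nat \<Rightarrow> nat \<Rightarrow> (nat \<Rightarrow> real) \<Rightarrow> (nat \<Rightarrow> real) \<Rightarrow> real" where
  "eps_star l r t \<delta>\<^sub>1 \<delta>\<^sub>2 =
     Sup {\<epsilon> \<in> {0..1}. \<forall>k\<in>{1..t + 1}. erasure_prob l r t \<epsilon> (\<lambda>i. \<delta>\<^sub>1 (t + 1 - i)) \<delta>\<^sub>2 k = 0}"

definition helper_out :: "nat \<Rightarrow> nat \<Rightarrow> nat \<Rightarrow> real \<Rightarrow> (nat \<Rightarrow> real) \<Rightarrow> nat \<Rightarrow> real" where
  "helper_out l r t \<epsilon> \<delta> i =
     (let u = de_u_lim l r t \<epsilon> (\<lambda>_. 1) \<delta> in
      1 - (\<Prod>k\<in>{1..i}.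
             (1 - \<epsilon> * u (Inner k) ^ (l - t) * (\<Prod>j\<in>{1..<k}. u (RightC k j))) ^ edge_mult r t))"

text \<open>\<open>helper_chain l r t k e \<delta>\<close> is $\Delta_k(e_1,\dots,e_k,\delta)$; \<open>e k\<close> belongs to the farthest helper.\<close>

primrec helper_chain ::
  "nat \<Rightarrow> nat \<Rightarrow> nat \<Rightarrow> nat \<Rightarrow> (nat \<Rightarrow> real) \<Rightarrow> (nat \<Rightarrow> real) \<Rightarrow> nat \<Rightarrow> real" where
  "helper_chain l r t 0 e \<delta> = \<delta>"
| "helper_chain l r t (Suc k) e \<delta> = helper_chain l r t k e (helper_out l r t (e (Suc k)) \<delta>)"

text \<open>
  \<open>E k\<close> is the erasure probability of the sub-block at offset \<open>k\<close> from the target; \<open>j\<close> is the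
  total number of helpers, assumed even in \<open>two_sided_success\<close>.
\<close>

definition two_sided_success ::
  "nat \<Rightarrow> nat \<Rightarrow> nat \<Rightarrow> 'a measure \<Rightarrow> (int \<Rightarrow> 'a \<Rightarrow> real) \<Rightarrow> nat
     \<Rightarrow> (nat \<Rightarrow> real) \<Rightarrow> (nat \<Rightarrow> real) \<Rightarrow> real" where
  "two_sided_success l r t M E j \<delta>\<^sub>1 \<delta>\<^sub>2 =
     measure M {\<omega> \<in> space M.
       E 0 \<omega> < eps_star l r t
         (helper_chain l r t (j div 2) (\<lambda>i. E (- int i) \<omega>) \<delta>\<^sub>1)
         (helper_chain l r t (j div 2) (\<lambda>i. E (int i) \<omega>) \<delta>\<^sub>2)}"

definition one_sided_success ::
  "nat \<Rightarrow> nat \<Rightarrow> nat \<Rightarrow> 'a measure \<Rightarrow> (int \<Rightarrow> 'a \<Rightarrow> real) \<Rightarrow> nat \<Rightarrow> (nat \<Rightarrow> real) \<Rightarrow> real" where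
  "one_sided_success l r t M E j \<delta> =
     measure M {\<omega> \<in> space M.
       E 0 \<omega> < eps_star l r t (\<lambda>_. 1) (helper_chain l r t j (\<lambda>i. E (int i) \<omega>) \<delta>)}"

end

theory Submission
  imports Defs
begin

text \<open>
  Density evolution is monotone in the erasure rate and in both incoming vectors, so
  \<open>eps_star\<close> is antitone and \<open>helper_out\<close> monotone. A helper below its threshold passes on
  \<open>0\<close>; any other helper passes on at most \<open>1\<close>. Each bound replaces the output of one helper on
  each side by these two extreme vectors and sums over the four success patterns, whose
  probabilities factor by independence: the farthest helpers for the first bound, the nearest ones,
  together with the chains behind them, for the second. The mixed patterns are merged by the
  left-right symmetry of \<open>eps_star\<close>.
\<close>

text \<open>Three obstacles shape the proof. The threshold is a supremum over density-evolution
  limits, so measurability of the success events is not immediate; they are rephrased through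
  rational admissible rates. The recursion does not look symmetric: position \<open>t + 1\<close>
  carries its own exponent, and right and left coupling labels have different index ranges. Only
  because \<open>t + 1\<close> divides \<open>r\<close> do all positions get the same multiplicity,
  and then reversing the positions exchanges the two sides. Independence alone does not suffice. The
  one-sided probability is defined for a target at \<open>0\<close> with helpers to its right, while
  the second bound uses it for the helpers at \<open>-1\<close> and \<open>1\<close> with the blocks
  behind them; and in the first bound the two mixed patterns are equal only in law. Both transfers
  use that an i.i.d. family has the same law when read through any injective index map.\<close>

fun valid_label :: "nat \<Rightarrow> label \<Rightarrow> bool" where
  "valid_label t (Inner k) \<longleftrightarrow> k \<in> {1..t + 1}"
| "valid_label t (RightC k i) \<longleftrightarrow> 1 \<le> i \<and> i < k \<and> k \<le> t + 1"
| "valid_label t (LeftC k i) \<longleftrightarrow> 1 \<le> k \<and> k \<le> i \<and> i \<le> t"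

definition unit_box :: "nat \<Rightarrow> (nat \<Rightarrow> real) \<Rightarrow> bool" where
  "unit_box t \<delta> \<longleftrightarrow> (\<forall>i\<in>{1..t}. \<delta> i \<in> {0..1})"

definition box_le :: "nat \<Rightarrow> (nat \<Rightarrow> real) \<Rightarrow> (nat \<Rightarrow> real) \<Rightarrow> bool" where
  "box_le t \<delta> \<delta>' \<longleftrightarrow> (\<forall>i\<in>{1..t}. \<delta> i \<le> \<delta>' i)"

lemma box_le_refl [simp]: "box_le t \<delta> \<delta>"
  by (simp add: box_le_def)

lemma unit_box_const [simp]: "unit_box t (\<lambda>_. 0)" "unit_box t (\<lambda>_. 1)"
  by (auto simp: unit_box_def)

lemma box_le_one: "unit_box t \<delta> \<Longrightarrow> box_le t \<delta> (\<lambda>_. 1)"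
  by (auto simp: unit_box_def box_le_def)

lemma unit_box_rev: "unit_box t \<delta> \<Longrightarrow> unit_box t (\<lambda>i. \<delta> (t + 1 - i))"
  unfolding unit_box_def by (intro ballI, elim bspec) auto

lemma box_le_rev: "box_le t \<delta> \<delta>' \<Longrightarrow> box_le t (\<lambda>i. \<delta> (t + 1 - i)) (\<lambda>i. \<delta>' (t + 1 - i))"
  unfolding box_le_def by (intro ballI, elim bspec) auto

subsection \<open>Monotonicity of density evolution\<close>

text \<open>Products are monotone only for nonnegative factors, so the lower bound is carried along
  with the comparison.\<close>

lemma var_update_mono:
  assumes "0 \<le> \<epsilon>" "\<epsilon> \<le> \<epsilon>'" "valid_label t a"
    and "\<And>b. valid_label t b \<Longrightarrow> 0 \<le> u b \<and> u b \<le> u' b"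
  shows "0 \<le> var_update l t \<epsilon> u a \<and> var_update l t \<epsilon> u a \<le> var_update l t \<epsilon>' u' a"
proof -
  have le: "u b \<le> u' b" "0 \<le> u b" "0 \<le> u' b" if "valid_label t b" for b
    using assms(4)[OF that] by auto
  show ?thesis
    using assms(1-3)
    by (cases a)
       (auto intro!: mult_mono prod_mono power_mono mult_nonneg_nonneg prod_nonneg zero_le_power le)
qed

text \<open>The update is one minus a product of factors \<open>1 - x b\<close> and
  \<open>1 - \<delta> i\<close>; the upper bounds by 1 keep these nonnegative. Validity of the label
  ensures that only coordinates in \<open>1..t\<close> are read, the only ones that
  \<open>box_le\<close> and \<open>unit_box\<close> constrain.\<close>

lemma check_update_mono:
  assumes "box_le t \<delta>L \<delta>L'" "box_le t \<delta>R \<delta>R'" "unit_box t \<delta>L'" "unit_box t \<delta>R'" "valid_label t a"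
    and "\<And>b. valid_label t b \<Longrightarrow> x b \<le> x' b \<and> x' b \<le> 1"
  shows "check_update r t \<delta>L \<delta>R x a \<le> check_update r t \<delta>L' \<delta>R' x' a"
proof -
  have le: "x b \<le> x' b" "x' b \<le> 1" "x b \<le> 1" if "valid_label t b" for b
    using assms(6)[OF that] by auto
  have d: "\<delta>L i \<le> \<delta>L' i" "\<delta>R i \<le> \<delta>R' i" "\<delta>L' i \<le> 1" "\<delta>R' i \<le> 1" "\<delta>L i \<le> 1" "\<delta>R i \<le> 1"
    if "1 \<le> i" "i \<le> t" for i
    using assms(1-4) that by (force simp: box_le_def unit_box_def)+
  show ?thesis
    using assms(5)
    by (cases a)
       (auto simp: Let_def
         intro!: mult_mono prod_mono power_mono mult_nonneg_nonneg prod_nonneg zero_le_power le d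
           diff_mono)
qed

lemma check_update_unit:
  assumes "unit_box t \<delta>L" "unit_box t \<delta>R" "valid_label t a"
    and "\<And>b. valid_label t b \<Longrightarrow> x b \<in> {0..1}"
  shows "check_update r t \<delta>L \<delta>R x a \<in> {0..1}"
proof -
  have le: "x b \<le> 1" if "valid_label t b" for b
    using assms(4)[OF that] by auto
  have d: "\<delta>L i \<le> 1" "\<delta>R i \<le> 1" if "1 \<le> i" "i \<le> t" for i
    using assms(1,2) that by (force simp: unit_box_def)+
  have "check_update r t \<delta>L \<delta>R x a \<le> 1"
    using assms(3)
    by (cases a)
       (auto simp: Let_def intro!: mult_nonneg_nonneg prod_nonneg zero_le_power le d)
  \<comment> \<open>The lower bound follows by monotonicity from the all-zero input, where every
    factor is 1 and the update is 0.\<close>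
  moreover have "0 \<le> check_update r t (\<lambda>_. 0) (\<lambda>_. 0) (\<lambda>_. 0) a"
    by (cases a) (simp_all add: Let_def)
  moreover have "check_update r t (\<lambda>_. 0) (\<lambda>_. 0) (\<lambda>_. 0) a \<le> check_update r t \<delta>L \<delta>R x a"
    using assms by (intro check_update_mono) (auto simp: box_le_def unit_box_def)
  ultimately show ?thesis by auto
qed

lemma de_x_unit:
  assumes "\<epsilon> \<in> {0..1}" "unit_box t \<delta>L" "unit_box t \<delta>R" "valid_label t a"
  shows "de_x l r t \<epsilon> \<delta>L \<delta>R n a \<in> {0..1}"
  using assms(4)
proof (induction n arbitrary: a)
  case (Suc n)
  let ?u = "check_update r t \<delta>L \<delta>R (de_x l r t \<epsilon> \<delta>L \<delta>R n)"
  have "?u b \<in> {0..1}" if "valid_label t b" for b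
    using check_update_unit[OF assms(2,3) that] Suc.IH by blast
  \<comment> \<open>The upper bound compares with rate 1 and constant messages 1, where the variable
    update equals 1.\<close>
  then have "0 \<le> var_update l t \<epsilon> ?u a \<and> var_update l t \<epsilon> ?u a \<le> var_update l t 1 (\<lambda>_. 1) a"
    using assms(1) Suc.prems by (intro var_update_mono) auto
  moreover have "var_update l t 1 (\<lambda>_. 1) a = 1"
    by (cases a) simp_all
  ultimately show ?case by simp
qed simp

lemma de_x_mono:
  assumes "0 \<le> \<epsilon>" "\<epsilon> \<le> \<epsilon>'" "\<epsilon>' \<le> 1" "box_le t \<delta>L \<delta>L'" "box_le t \<delta>R \<delta>R'"
    and "unit_box t \<delta>L" "unit_box t \<delta>R" "unit_box t \<delta>L'" "unit_box t \<delta>R'" "valid_label t a"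
  shows "de_x l r t \<epsilon> \<delta>L \<delta>R n a \<le> de_x l r t \<epsilon>' \<delta>L' \<delta>R' n a"
  using assms(10)
proof (induction n arbitrary: a)
  case (Suc n)
  let ?x = "de_x l r t \<epsilon> \<delta>L \<delta>R n" and ?x' = "de_x l r t \<epsilon>' \<delta>L' \<delta>R' n"
  have x: "?x b \<in> {0..1}" "?x' b \<in> {0..1}" if "valid_label t b" for b
    using assms that by (intro de_x_unit; simp)+
  have "0 \<le> check_update r t \<delta>L \<delta>R ?x b \<and> check_update r t \<delta>L \<delta>R ?x b \<le> check_update r t \<delta>L' \<delta>R' ?x' b"
    if "valid_label t b" for b
    using check_update_unit[OF assms(6,7) that x(1)] check_update_mono[OF assms(4,5,8,9) that]
      Suc.IH x by auto
  then show ?case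
    using var_update_mono[OF assms(1,2) Suc.prems] by simp
qed simp

text \<open>The start value 1 dominates the first iterate, and the monotone updates propagate this
  single comparison to all later ones.\<close>

lemma de_x_Suc_le:
  assumes "\<epsilon> \<in> {0..1}" "unit_box t \<delta>L" "unit_box t \<delta>R" "valid_label t a"
  shows "de_x l r t \<epsilon> \<delta>L \<delta>R (Suc n) a \<le> de_x l r t \<epsilon> \<delta>L \<delta>R n a"
  using assms(4)
proof (induction n arbitrary: a)
  case 0
  then show ?case using de_x_unit[OF assms(1-3), of a l r "Suc 0"] by simp
next
  case (Suc n)
  let ?x = "de_x l r t \<epsilon> \<delta>L \<delta>R"
  have x: "?x m b \<in> {0..1}" if "valid_label t b" for b m
    using assms that by (intro de_x_unit)
  have "0 \<le> check_update r t \<delta>L \<delta>R (?x (Suc n)) b \<and>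
      check_update r t \<delta>L \<delta>R (?x (Suc n)) b \<le> check_update r t \<delta>L \<delta>R (?x n) b"
    if "valid_label t b" for b
    using check_update_unit[OF assms(2,3) that x] Suc.IH x that
    by (auto intro!: check_update_mono assms simp del: de_x.simps)
  then show ?case
    using var_update_mono[of \<epsilon> \<epsilon> t a "check_update r t \<delta>L \<delta>R (?x (Suc n))"
        "check_update r t \<delta>L \<delta>R (?x n)" l] assms(1) Suc.prems
    by (metis atLeastAtMost_iff de_x.simps(2) order_refl)
qed

lemma de_u_unit:
  assumes "\<epsilon> \<in> {0..1}" "unit_box t \<delta>L" "unit_box t \<delta>R" "valid_label t a"
  shows "de_u l r t \<epsilon> \<delta>L \<delta>R n a \<in> {0..1}"
  unfolding de_u_def using assms by (intro check_update_unit de_x_unit)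

lemma de_u_mono:
  assumes "0 \<le> \<epsilon>" "\<epsilon> \<le> \<epsilon>'" "\<epsilon>' \<le> 1" "box_le t \<delta>L \<delta>L'" "box_le t \<delta>R \<delta>R'"
    and "unit_box t \<delta>L" "unit_box t \<delta>R" "unit_box t \<delta>L'" "unit_box t \<delta>R'" "valid_label t a"
  shows "de_u l r t \<epsilon> \<delta>L \<delta>R n a \<le> de_u l r t \<epsilon>' \<delta>L' \<delta>R' n a"
proof -
  have "de_x l r t \<epsilon>' \<delta>L' \<delta>R' m b \<in> {0..1}" if "valid_label t b" for m b
    using assms that by (intro de_x_unit) auto
  then show ?thesis
    unfolding de_u_def using assms by (intro check_update_mono conjI de_x_mono) auto
qed

text \<open>For \<open>n = 0\<close> the truncated index \<open>n - 1\<close> makes both sides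
  functions of the same start value, so equality holds; for larger \<open>n\<close> the decrease
  comes from \<open>de_x\<close>.\<close>

lemma de_u_Suc_le:
  assumes "\<epsilon> \<in> {0..1}" "unit_box t \<delta>L" "unit_box t \<delta>R" "valid_label t a"
  shows "de_u l r t \<epsilon> \<delta>L \<delta>R (Suc n) a \<le> de_u l r t \<epsilon> \<delta>L \<delta>R n a"
proof (cases n)
  case (Suc m)
  have "de_x l r t \<epsilon> \<delta>L \<delta>R m b \<le> 1" if "valid_label t b" for b
    using de_x_unit[OF assms(1-3) that] by simp
  then show ?thesis
    unfolding de_u_def Suc diff_Suc_1 using assms by (intro check_update_mono conjI de_x_Suc_le) auto
qed (simp add: de_u_def)

text \<open>The limit operator \<open>lim\<close> is informative only once convergence is known;
  here the sequence decreases and is bounded below by 0.\<close>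

lemma de_u_LIMSEQ:
  assumes "\<epsilon> \<in> {0..1}" "unit_box t \<delta>L" "unit_box t \<delta>R" "valid_label t a"
  shows "(\<lambda>n. de_u l r t \<epsilon> \<delta>L \<delta>R n a) \<longlonglongrightarrow> de_u_lim l r t \<epsilon> \<delta>L \<delta>R a"
proof -
  have "decseq (\<lambda>n. de_u l r t \<epsilon> \<delta>L \<delta>R n a)"
    using de_u_Suc_le[OF assms] by (simp add: decseq_Suc_iff)
  moreover have "0 \<le> de_u l r t \<epsilon> \<delta>L \<delta>R n a" for n
    using de_u_unit[OF assms] by simp
  ultimately have "convergent (\<lambda>n. de_u l r t \<epsilon> \<delta>L \<delta>R n a)"
    by (auto intro: decseq_convergent[of _ 0] simp: convergent_def)
  then show ?thesis
    by (simp add: convergent_LIMSEQ_iff de_u_lim_def)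
qed

lemma de_u_lim_unit:
  assumes "\<epsilon> \<in> {0..1}" "unit_box t \<delta>L" "unit_box t \<delta>R" "valid_label t a"
  shows "de_u_lim l r t \<epsilon> \<delta>L \<delta>R a \<in> {0..1}"
  using de_u_unit[OF assms] by (intro closed_sequentially[OF _ _ de_u_LIMSEQ[OF assms]]) auto

lemma de_u_lim_mono:
  assumes "0 \<le> \<epsilon>" "\<epsilon> \<le> \<epsilon>'" "\<epsilon>' \<le> 1" "box_le t \<delta>L \<delta>L'" "box_le t \<delta>R \<delta>R'"
    and "unit_box t \<delta>L" "unit_box t \<delta>R" "unit_box t \<delta>L'" "unit_box t \<delta>R'" "valid_label t a"
  shows "de_u_lim l r t \<epsilon> \<delta>L \<delta>R a \<le> de_u_lim l r t \<epsilon>' \<delta>L' \<delta>R' a"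
  using assms by (intro LIMSEQ_le[OF de_u_LIMSEQ de_u_LIMSEQ]) (auto intro!: de_u_mono)

section \<open>Erasure probabilities and helper outputs\<close>

lemma erasure_prob_mono:
  assumes "0 \<le> \<epsilon>" "\<epsilon> \<le> \<epsilon>'" "\<epsilon>' \<le> 1" "box_le t \<delta>L \<delta>L'" "box_le t \<delta>R \<delta>R'"
    and "unit_box t \<delta>L" "unit_box t \<delta>R" "unit_box t \<delta>L'" "unit_box t \<delta>R'" "k \<in> {1..t + 1}"
  shows "erasure_prob l r t \<epsilon> \<delta>L \<delta>R k \<le> erasure_prob l r t \<epsilon>' \<delta>L' \<delta>R' k"
proof -
  have u: "0 \<le> de_u_lim l r t \<epsilon> \<delta>L \<delta>R b" "0 \<le> de_u_lim l r t \<epsilon>' \<delta>L' \<delta>R' b"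
      "de_u_lim l r t \<epsilon> \<delta>L \<delta>R b \<le> de_u_lim l r t \<epsilon>' \<delta>L' \<delta>R' b"
    if "valid_label t b" for b
    using de_u_lim_unit[of \<epsilon> t \<delta>L \<delta>R b l r] de_u_lim_unit[of \<epsilon>' t \<delta>L' \<delta>R' b l r]
      de_u_lim_mono[OF assms(1-9) that] assms that by auto
  show ?thesis
    unfolding erasure_prob_def Let_def using assms(1-3,10)
    by (auto intro!: mult_mono prod_mono power_mono mult_nonneg_nonneg prod_nonneg zero_le_power u)
qed

lemma erasure_prob_unit:
  assumes "\<epsilon> \<in> {0..1}" "unit_box t \<delta>L" "unit_box t \<delta>R" "k \<in> {1..t + 1}"
  shows "erasure_prob l r t \<epsilon> \<delta>L \<delta>R k \<in> {0..1}"
proof -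
  have u: "0 \<le> de_u_lim l r t \<epsilon> \<delta>L \<delta>R b" "de_u_lim l r t \<epsilon> \<delta>L \<delta>R b \<le> 1"
    if "valid_label t b" for b
    using de_u_lim_unit[OF assms(1-3) that, of l r] by auto
  show ?thesis
    unfolding erasure_prob_def Let_def using assms(1,4)
    by (auto intro!: mult_le_one prod_le_1 power_le_one mult_nonneg_nonneg prod_nonneg zero_le_power u)
qed

text \<open>With no information from the left, \<open>1 - \<delta>L i\<close> vanishes, so all left
  coupling messages are constantly 1 and their product can be inserted freely. A helper's output is
  thus governed by the same erasure probabilities as the target, and monotonicity and measurability
  carry over.\<close>

lemma helper_out_eq:
  "helper_out l r t \<epsilon> \<delta> i =
     1 - (\<Prod>k\<in>{1..i}. (1 - erasure_prob l r t \<epsilon> (\<lambda>_. 1) \<delta> k) ^ edge_mult r t)"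
proof -
  have "de_u_lim l r t \<epsilon> (\<lambda>_. 1) \<delta> (LeftC k j) = 1" for k j
    by (simp add: de_u_lim_def de_u_def Let_def)
  then show ?thesis
    by (simp add: helper_out_def erasure_prob_def Let_def)
qed

lemma helper_out_unit:
  assumes "\<epsilon> \<in> {0..1}" "unit_box t \<delta>"
  shows "unit_box t (helper_out l r t \<epsilon> \<delta>)"
  unfolding unit_box_def
proof
  fix i assume i: "i \<in> {1..t}"
  have "erasure_prob l r t \<epsilon> (\<lambda>_. 1) \<delta> k \<in> {0..1}" if "k \<in> {1..i}" for k
    using assms i that by (intro erasure_prob_unit) auto
  then show "helper_out l r t \<epsilon> \<delta> i \<in> {0..1}"
    unfolding helper_out_eq by (auto intro!: prod_le_1 power_le_one prod_nonneg)
qed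

lemma helper_out_mono:
  assumes "\<epsilon> \<in> {0..1}" "unit_box t \<delta>" "unit_box t \<delta>'" "box_le t \<delta> \<delta>'"
  shows "box_le t (helper_out l r t \<epsilon> \<delta>) (helper_out l r t \<epsilon> \<delta>')"
  unfolding box_le_def
proof
  fix i assume i: "i \<in> {1..t}"
  have "erasure_prob l r t \<epsilon> (\<lambda>_. 1) \<delta> k \<le> erasure_prob l r t \<epsilon> (\<lambda>_. 1) \<delta>' k"
    "erasure_prob l r t \<epsilon> (\<lambda>_. 1) \<delta>' k \<in> {0..1}" if "k \<in> {1..i}" for k
    using assms i that by (intro erasure_prob_unit erasure_prob_mono; auto)+
  then show "helper_out l r t \<epsilon> \<delta> i \<le> helper_out l r t \<epsilon> \<delta>' i"
    unfolding helper_out_eq by (intro diff_mono prod_mono conjI power_mono zero_le_power order_refl) auto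
qed

lemma helper_chain_unit:
  assumes "\<And>i. i \<in> {1..k} \<Longrightarrow> e i \<in> {0..1}" "unit_box t \<delta>"
  shows "unit_box t (helper_chain l r t k e \<delta>)"
  using assms
proof (induction k arbitrary: \<delta>)
  case (Suc k)
  show ?case
    unfolding helper_chain.simps by (intro Suc.IH helper_out_unit Suc.prems) auto
qed simp

lemma helper_chain_mono:
  assumes "\<And>i. i \<in> {1..k} \<Longrightarrow> e i \<in> {0..1}" "unit_box t \<delta>" "unit_box t \<delta>'" "box_le t \<delta> \<delta>'"
  shows "box_le t (helper_chain l r t k e \<delta>) (helper_chain l r t k e \<delta>')"
  using assms
proof (induction k arbitrary: \<delta> \<delta>')
  case (Suc k)
  show ?case
    unfolding helper_chain.simps
    by (intro Suc.IH helper_out_unit helper_out_mono Suc.prems) auto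
qed simp

lemma helper_chain_cong:
  assumes "\<And>i. i \<in> {1..k} \<Longrightarrow> e i = e' i"
  shows "helper_chain l r t k e \<delta> = helper_chain l r t k e' \<delta>"
  using assms by (induction k arbitrary: \<delta>) simp_all

text \<open>The defining recursion peels off the farthest helper, as the first bound requires; the
  second bound needs the nearest one exposed.\<close>

lemma helper_chain_Suc_nearest:
  "helper_chain l r t (Suc k) e \<delta> = helper_out l r t (e 1) (helper_chain l r t k (\<lambda>i. e (Suc i)) \<delta>)"
  by (induction k arbitrary: \<delta>) simp_all

subsection \<open>Mirror symmetry\<close>

text \<open>Reflection of the sub-block. Positions run over \<open>1..t + 1\<close> and coordinates
  over \<open>1..t\<close>, whence the offsets \<open>t + 2\<close> and \<open>t + 1\<close>; their
  difference turns the strict \<open>i < k\<close> of right labels into the weak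
  \<open>k \<le> i\<close> of left labels.\<close>

fun mirror :: "nat \<Rightarrow> label \<Rightarrow> label" where
  "mirror t (Inner k) = Inner (t + 2 - k)"
| "mirror t (RightC k i) = LeftC (t + 2 - k) (t + 1 - i)"
| "mirror t (LeftC k i) = RightC (t + 2 - k) (t + 1 - i)"

text \<open>Since \<open>(t + 1) dvd r\<close>, position \<open>t + 1\<close> carries the same multiplicity \<open>r - t * w = w\<close> as all others.\<close>

lemma check_update_uniform:
  assumes "(t + 1) dvd r" "w = edge_mult r t"
  shows "k \<in> {1..t + 1} \<Longrightarrow> check_update r t \<delta>L \<delta>R x (Inner k) =
      1 - (1 - x (Inner k)) ^ (w - 1) * (\<Prod>j\<in>{1..t + 1} - {k}. (1 - x (Inner j)) ^ w)" (is "_ \<Longrightarrow> ?I")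
    and "\<lbrakk>1 \<le> i; i < k; k \<le> t + 1\<rbrakk> \<Longrightarrow> check_update r t \<delta>L \<delta>R x (RightC k i) =
      1 - (1 - \<delta>R i) * (1 - x (RightC k i)) ^ (w - 1)
        * (\<Prod>j\<in>{i + 1..t + 1} - {k}. (1 - x (RightC j i)) ^ w)" (is "_ \<Longrightarrow> _ \<Longrightarrow> _ \<Longrightarrow> ?R")
    and "check_update r t \<delta>L \<delta>R x (LeftC k i) =
      1 - (1 - \<delta>L i) * (1 - x (LeftC k i)) ^ (w - 1)
        * (\<Prod>j\<in>{1..i} - {k}. (1 - x (LeftC j i)) ^ w)"
proof -
  have "r = (t + 1) * w"
    using dvd_mult_div_cancel[OF assms(1)] by (simp only: assms(2) edge_mult_def)
  then have w: "r - t * w = w" "r - Suc (t * w) = w - Suc 0" by simp_all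
  show ?I if k: "k \<in> {1..t + 1}"
  proof (cases "k = t + 1")
    case True
    then have "{1..t + 1} - {k} = {1..t}" by auto
    then show ?thesis using True w by (simp add: Let_def flip: assms(2))
  next
    case False
    then have "{1..t + 1} - {k} = insert (t + 1) ({1..t} - {k})" using k by auto
    then show ?thesis using False w by (simp add: Let_def mult_ac flip: assms(2))
  qed
  show ?R if k: "1 \<le> i" "i < k" "k \<le> t + 1"
  proof (cases "k = t + 1")
    case True
    then have "{i + 1..t + 1} - {k} = {i + 1..t}" by auto
    then show ?thesis using True w by (simp add: Let_def flip: assms(2))
  next
    case False
    then have "{i + 1..t + 1} - {k} = insert (t + 1) ({i + 1..t} - {k})" using k by auto
    then show ?thesis using False w by (simp add: Let_def mult_ac flip: assms(2))
  qed
qed (simp add: Let_def assms(2))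

text \<open>With uniform multiplicities an update is a product over all other positions attached to
  the same check, and this is insensitive to their order. The right check \<open>i\<close> covers
  positions \<open>i + 1..t + 1\<close>, whose reversal \<open>1..t + 1 - i\<close> is what the left
  check \<open>t + 1 - i\<close> covers.\<close>

lemma check_update_mirror:
  assumes "(t + 1) dvd r" "valid_label t a"
    and "\<And>i. i \<in> {1..t} \<Longrightarrow> \<delta>L' i = \<delta>R (t + 1 - i) \<and> \<delta>R' i = \<delta>L (t + 1 - i)"
    and "\<And>b. valid_label t b \<Longrightarrow> x' b = x (mirror t b)"
  shows "check_update r t \<delta>L' \<delta>R' x' a = check_update r t \<delta>L \<delta>R x (mirror t a)"
proof (cases a)
  case (Inner k)
  then have k: "k \<in> {1..t + 1}" "t + 2 - k \<in> {1..t + 1}" using assms(2) by auto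
  have "(\<Prod>j\<in>{1..t + 1} - {k}. (1 - x' (Inner j)) ^ edge_mult r t) =
      (\<Prod>j\<in>{1..t + 1} - {t + 2 - k}. (1 - x (Inner j)) ^ edge_mult r t)"
    using k
    by (intro prod.reindex_bij_witness[where i = "\<lambda>j. t + 2 - j" and j = "\<lambda>j. t + 2 - j"])
       (auto simp: assms(4))
  then show ?thesis
    unfolding Inner mirror.simps check_update_uniform(1)[OF assms(1) refl k(1)]
      check_update_uniform(1)[OF assms(1) refl k(2)]
    using k(1) by (simp add: assms(4))
next
  case (RightC k i)
  then have k: "1 \<le> i" "i < k" "k \<le> t + 1" using assms(2) by auto
  have "(\<Prod>j\<in>{i + 1..t + 1} - {k}. (1 - x' (RightC j i)) ^ edge_mult r t) =
      (\<Prod>j\<in>{1..t + 1 - i} - {t + 2 - k}. (1 - x (LeftC j (t + 1 - i))) ^ edge_mult r t)"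
    using k
    by (intro prod.reindex_bij_witness[where i = "\<lambda>j. t + 2 - j" and j = "\<lambda>j. t + 2 - j"])
       (auto simp: assms(4))
  then show ?thesis
    unfolding RightC mirror.simps check_update_uniform(2)[OF assms(1) refl k]
      check_update_uniform(3)[OF assms(1) refl]
    using k assms(3)[of i] by (simp add: assms(4))
next
  case (LeftC k i)
  then have k: "1 \<le> k" "k \<le> i" "i \<le> t" using assms(2) by auto
  have k': "1 \<le> t + 1 - i" "t + 1 - i < t + 2 - k" "t + 2 - k \<le> t + 1" using k by auto
  have "(\<Prod>j\<in>{1..i} - {k}. (1 - x' (LeftC j i)) ^ edge_mult r t) =
      (\<Prod>j\<in>{t + 1 - i + 1..t + 1} - {t + 2 - k}. (1 - x (RightC j (t + 1 - i))) ^ edge_mult r t)"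
    using k
    by (intro prod.reindex_bij_witness[where i = "\<lambda>j. t + 2 - j" and j = "\<lambda>j. t + 2 - j"])
       (auto simp: assms(4))
  then show ?thesis
    unfolding LeftC mirror.simps check_update_uniform(2)[OF assms(1) refl k']
      check_update_uniform(3)[OF assms(1) refl]
    using k assms(3)[of i] by (simp add: assms(4))
qed

text \<open>The set \<open>I\<close> holds the omitted edges: it is empty where a variable update
  multiplies over all coupling edges of a side, and a singleton where the edge being updated is left
  out.\<close>

lemma prod_mirror:
  fixes u u' :: "label \<Rightarrow> real"
  assumes "k \<in> {1..t + 1}" "\<And>b. valid_label t b \<Longrightarrow> u' b = u (mirror t b)"
  shows "(\<Prod>j\<in>{1..<k} - I. u' (RightC k j)) =
      (\<Prod>j\<in>{t + 2 - k..t} - {j. t + 1 - j \<in> I}. u (LeftC (t + 2 - k) j))" (is ?R)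
    and "(\<Prod>j\<in>{k..t} - I. u' (LeftC k j)) =
      (\<Prod>j\<in>{1..<t + 2 - k} - {j. t + 1 - j \<in> I}. u (RightC (t + 2 - k) j))" (is ?L)
proof -
  show ?R ?L
    using assms(1)
    by (intro prod.reindex_bij_witness[where i = "\<lambda>j. t + 1 - j" and j = "\<lambda>j. t + 1 - j"];
        simp add: assms(2); linarith?)+
qed

lemma var_update_mirror:
  assumes "valid_label t a" "\<And>b. valid_label t b \<Longrightarrow> u' b = u (mirror t b)"
  shows "var_update l t \<epsilon> u' a = var_update l t \<epsilon> u (mirror t a)"
proof (cases a)
  case (Inner k)
  then have "k \<in> {1..t + 1}" using assms(1) by simp
  then show ?thesis
    using prod_mirror[where I = "{}" and u = u and u' = u' and k = k and t = t] assms(2)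
    by (simp add: Inner)
next
  case (RightC k i)
  then have "k \<in> {1..t + 1}" "{j. t + 1 - j \<in> {i}} = {t + 1 - i}" using assms(1) by auto
  then show ?thesis
    using prod_mirror(1)[where I = "{i}" and u = u and u' = u' and k = k and t = t]
      prod_mirror(2)[where I = "{}" and u = u and u' = u' and k = k and t = t] assms(2)
    by (simp add: RightC)
next
  case (LeftC k i)
  then have "k \<in> {1..t + 1}" "{j. t + 1 - j \<in> {i}} = {t + 1 - i}" using assms(1) by auto
  then show ?thesis
    using prod_mirror(1)[where I = "{}" and u = u and u' = u' and k = k and t = t]
      prod_mirror(2)[where I = "{i}" and u = u and u' = u' and k = k and t = t] assms(2)
    by (simp add: LeftC)
qed

lemma de_x_mirror:
  assumes "(t + 1) dvd r" "valid_label t a"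
    and "\<And>i. i \<in> {1..t} \<Longrightarrow> \<delta>L' i = \<delta>R (t + 1 - i) \<and> \<delta>R' i = \<delta>L (t + 1 - i)"
  shows "de_x l r t \<epsilon> \<delta>L' \<delta>R' n a = de_x l r t \<epsilon> \<delta>L \<delta>R n (mirror t a)"
  using assms(2)
proof (induction n arbitrary: a)
  case (Suc n)
  then show ?case
    unfolding de_x.simps
    by (intro var_update_mirror check_update_mirror assms(1,3)) auto
qed simp

lemma de_u_lim_mirror:
  assumes "(t + 1) dvd r" "valid_label t a"
    and "\<And>i. i \<in> {1..t} \<Longrightarrow> \<delta>L' i = \<delta>R (t + 1 - i) \<and> \<delta>R' i = \<delta>L (t + 1 - i)"
  shows "de_u_lim l r t \<epsilon> \<delta>L' \<delta>R' a = de_u_lim l r t \<epsilon> \<delta>L \<delta>R (mirror t a)"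
proof -
  have "check_update r t \<delta>L' \<delta>R' (de_x l r t \<epsilon> \<delta>L' \<delta>R' n) a =
      check_update r t \<delta>L \<delta>R (de_x l r t \<epsilon> \<delta>L \<delta>R n) (mirror t a)" for n
    by (intro check_update_mirror de_x_mirror assms)
  then show ?thesis
    by (simp add: de_u_lim_def de_u_def)
qed

lemma erasure_prob_mirror:
  assumes "(t + 1) dvd r" "k \<in> {1..t + 1}"
    and "\<And>i. i \<in> {1..t} \<Longrightarrow> \<delta>L' i = \<delta>R (t + 1 - i) \<and> \<delta>R' i = \<delta>L (t + 1 - i)"
  shows "erasure_prob l r t \<epsilon> \<delta>L' \<delta>R' k = erasure_prob l r t \<epsilon> \<delta>L \<delta>R (t + 2 - k)"
proof -
  have u: "de_u_lim l r t \<epsilon> \<delta>L' \<delta>R' b = de_u_lim l r t \<epsilon> \<delta>L \<delta>R (mirror t b)"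
    if "valid_label t b" for b
    by (intro de_u_lim_mirror assms that)
  show ?thesis
    using prod_mirror[where I = "{}" and u = "de_u_lim l r t \<epsilon> \<delta>L \<delta>R"
        and u' = "de_u_lim l r t \<epsilon> \<delta>L' \<delta>R'", OF assms(2) u] u[of "Inner k"] assms(2)
    by (simp add: erasure_prob_def Let_def)
qed

subsection \<open>Decoding below the threshold\<close>

text \<open>
  For erasure rates and vectors in the unit range, \<open>decodes\<close> says \<open>\<epsilon> < eps_star l r t \<delta>\<^sub>1 \<delta>\<^sub>2\<close>;
  the countable range of \<open>q\<close> makes it measurable without any restriction on the arguments.
\<close>

definition decodes :: "nat \<Rightarrow> nat \<Rightarrow> nat \<Rightarrow> real \<Rightarrow> (nat \<Rightarrow> real) \<Rightarrow> (nat \<Rightarrow> real) \<Rightarrow> bool" where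
  "decodes l r t \<epsilon> \<delta>\<^sub>1 \<delta>\<^sub>2 \<longleftrightarrow>
     (\<exists>q\<in>\<rat> \<inter> {0..1}. \<epsilon> < q \<and>
       (\<forall>k\<in>{1..t + 1}. erasure_prob l r t q (\<lambda>i. \<delta>\<^sub>1 (t + 1 - i)) \<delta>\<^sub>2 k = 0))"

lemma erasure_prob_eq_0_mono:
  assumes "erasure_prob l r t \<epsilon>' \<delta>L' \<delta>R' k = 0" "0 \<le> \<epsilon>" "\<epsilon> \<le> \<epsilon>'" "\<epsilon>' \<le> 1"
    and "box_le t \<delta>L \<delta>L'" "box_le t \<delta>R \<delta>R'"
    and "unit_box t \<delta>L" "unit_box t \<delta>R" "unit_box t \<delta>L'" "unit_box t \<delta>R'" "k \<in> {1..t + 1}"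
  shows "erasure_prob l r t \<epsilon> \<delta>L \<delta>R k = 0"
  using erasure_prob_mono[OF assms(2-), of l r] erasure_prob_unit[of \<epsilon> t \<delta>L \<delta>R k l r] assms
  by simp

text \<open>Lying strictly below the supremum means having an admissible rate \<open>q\<close> above
  \<epsilon>. Admissibility passes to smaller rates by monotonicity, so a rational strictly between
  \<epsilon> and \<open>q\<close> serves as well.\<close>

lemma less_eps_star_iff_decodes:
  assumes "0 \<le> \<epsilon>" "unit_box t \<delta>\<^sub>1" "unit_box t \<delta>\<^sub>2"
  shows "\<epsilon> < eps_star l r t \<delta>\<^sub>1 \<delta>\<^sub>2 \<longleftrightarrow> decodes l r t \<epsilon> \<delta>\<^sub>1 \<delta>\<^sub>2"
proof -
  let ?P = "\<lambda>q. \<forall>k\<in>{1..t + 1}. erasure_prob l r t q (\<lambda>i. \<delta>\<^sub>1 (t + 1 - i)) \<delta>\<^sub>2 k = 0"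
  \<comment> \<open>The factor \<epsilon> makes every erasure probability vanish at rate 0, so the
    supremum is over a nonempty set.\<close>
  have "0 \<in> {q \<in> {0..1}. ?P q}" by (simp add: erasure_prob_def Let_def)
  then have "{q \<in> {0..1}. ?P q} \<noteq> {}" by blast
  moreover have "bdd_above {q \<in> {0..1}. ?P q}" by (rule bdd_aboveI[of _ 1]) auto
  ultimately have "\<epsilon> < eps_star l r t \<delta>\<^sub>1 \<delta>\<^sub>2 \<longleftrightarrow> (\<exists>q\<in>{q \<in> {0..1}. ?P q}. \<epsilon> < q)"
    unfolding eps_star_def by (rule less_cSup_iff)
  also have "\<dots> \<longleftrightarrow> decodes l r t \<epsilon> \<delta>\<^sub>1 \<delta>\<^sub>2"
  proof
    assume "\<exists>q\<in>{q \<in> {0..1}. ?P q}. \<epsilon> < q"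
    then obtain q where q: "q \<in> {0..1}" "?P q" "\<epsilon> < q" by blast
    from q(3) obtain s where s: "s \<in> \<rat>" "\<epsilon> < s" "s < q" using Rats_dense_in_real by blast
    have "erasure_prob l r t s (\<lambda>i. \<delta>\<^sub>1 (t + 1 - i)) \<delta>\<^sub>2 k = 0" if k: "k \<in> {1..t + 1}" for k
      by (rule erasure_prob_eq_0_mono[OF q(2)[rule_format, OF k]])
         (use q s k assms unit_box_rev[of t \<delta>\<^sub>1] in auto)
    with s q assms(1) show "decodes l r t \<epsilon> \<delta>\<^sub>1 \<delta>\<^sub>2"
      unfolding decodes_def by (intro bexI[of _ s]) auto
  qed (auto simp: decodes_def)
  finally show ?thesis .
qed

lemma decodes_antimono:
  assumes "decodes l r t \<epsilon> \<delta>\<^sub>1' \<delta>\<^sub>2'" "box_le t \<delta>\<^sub>1 \<delta>\<^sub>1'" "box_le t \<delta>\<^sub>2 \<delta>\<^sub>2'"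
    and "unit_box t \<delta>\<^sub>1" "unit_box t \<delta>\<^sub>2" "unit_box t \<delta>\<^sub>1'" "unit_box t \<delta>\<^sub>2'"
  shows "decodes l r t \<epsilon> \<delta>\<^sub>1 \<delta>\<^sub>2"
proof -
  from assms(1) obtain q where q: "q \<in> \<rat>" "q \<in> {0..1}" "\<epsilon> < q"
    and P: "\<And>k. k \<in> {1..t + 1} \<Longrightarrow> erasure_prob l r t q (\<lambda>i. \<delta>\<^sub>1' (t + 1 - i)) \<delta>\<^sub>2' k = 0"
    unfolding decodes_def by blast
  have "erasure_prob l r t q (\<lambda>i. \<delta>\<^sub>1 (t + 1 - i)) \<delta>\<^sub>2 k = 0" if "k \<in> {1..t + 1}" for k
    using q(2) that assms
    by (intro erasure_prob_eq_0_mono[OF P[OF that]] box_le_rev unit_box_rev) auto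
  with q show ?thesis unfolding decodes_def by blast
qed

text \<open>Because the left vector is listed in reversed order, reflecting the sub-block swaps
  exactly the two arguments: undoing the reversal in \<open>1..t\<close> gives back the original
  coordinates. The rational witness stays the same.\<close>

lemma decodes_commute:
  assumes "(t + 1) dvd r" "decodes l r t \<epsilon> \<delta>\<^sub>1 \<delta>\<^sub>2"
  shows "decodes l r t \<epsilon> \<delta>\<^sub>2 \<delta>\<^sub>1"
proof -
  from assms(2) obtain q where q: "q \<in> \<rat>" "q \<in> {0..1}" "\<epsilon> < q"
    and P: "\<And>k. k \<in> {1..t + 1} \<Longrightarrow> erasure_prob l r t q (\<lambda>i. \<delta>\<^sub>1 (t + 1 - i)) \<delta>\<^sub>2 k = 0"
    unfolding decodes_def by blast
  have "erasure_prob l r t q (\<lambda>i. \<delta>\<^sub>2 (t + 1 - i)) \<delta>\<^sub>1 k = 0" if "k \<in> {1..t + 1}" for k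
  proof -
    have "erasure_prob l r t q (\<lambda>i. \<delta>\<^sub>2 (t + 1 - i)) \<delta>\<^sub>1 k =
        erasure_prob l r t q (\<lambda>i. \<delta>\<^sub>1 (t + 1 - i)) \<delta>\<^sub>2 (t + 2 - k)"
      by (rule erasure_prob_mirror[OF assms(1) that]) auto
    also have "\<dots> = 0" using that by (intro P) auto
    finally show ?thesis .
  qed
  with q show ?thesis unfolding decodes_def by blast
qed

text \<open>A helper faces the target's decoding problem with the constant vector 1 on one side, and
  reversal leaves a constant vector unchanged. All its erasure probabilities therefore vanish at
  some rate above \<epsilon>, hence at \<epsilon>.\<close>

lemma helper_out_decoded:
  assumes "decodes l r t \<epsilon> (\<lambda>_. 1) \<delta>" "0 \<le> \<epsilon>" "unit_box t \<delta>" "i \<le> t"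
  shows "helper_out l r t \<epsilon> \<delta> i = 0"
proof -
  from assms(1) obtain q where q: "q \<in> {0..1}" "\<epsilon> < q"
    and P: "\<And>k. k \<in> {1..t + 1} \<Longrightarrow> erasure_prob l r t q (\<lambda>_. 1) \<delta> k = 0"
    unfolding decodes_def by blast
  have "erasure_prob l r t \<epsilon> (\<lambda>_. 1) \<delta> k = 0" if "k \<in> {1..i}" for k
    using q that assms by (intro erasure_prob_eq_0_mono[OF P]) auto
  then show ?thesis unfolding helper_out_eq by simp
qed

section \<open>Measurability of the decoding event\<close>

lemma erasure_prob_measurable:
  assumes "\<epsilon> \<in> borel_measurable N"
    and "\<And>i. i \<in> {1..t} \<Longrightarrow> (\<lambda>\<omega>. \<delta>L \<omega> i) \<in> borel_measurable N"
    and "\<And>i. i \<in> {1..t} \<Longrightarrow> (\<lambda>\<omega>. \<delta>R \<omega> i) \<in> borel_measurable N"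
    and "k \<in> {1..t + 1}"
  shows "(\<lambda>\<omega>. erasure_prob l r t (\<epsilon> \<omega>) (\<delta>L \<omega>) (\<delta>R \<omega>) k) \<in> borel_measurable N"
proof -
  let ?x = "\<lambda>n \<omega>. de_x l r t (\<epsilon> \<omega>) (\<delta>L \<omega>) (\<delta>R \<omega>) n"
  have check: "(\<lambda>\<omega>. check_update r t (\<delta>L \<omega>) (\<delta>R \<omega>) (x \<omega>) a) \<in> borel_measurable N"
    if "valid_label t a" "\<And>b. valid_label t b \<Longrightarrow> (\<lambda>\<omega>. x \<omega> b) \<in> borel_measurable N" for x a
    using that(1) assms(2,3)
    by (cases a)
       (auto simp: Let_def intro!: measurable_If borel_measurable_diff borel_measurable_times borel_measurable_prod
         borel_measurable_power borel_measurable_const that(2))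
  have var: "(\<lambda>\<omega>. var_update l t (\<epsilon> \<omega>) (u \<omega>) a) \<in> borel_measurable N"
    if "valid_label t a" "\<And>b. valid_label t b \<Longrightarrow> (\<lambda>\<omega>. u \<omega> b) \<in> borel_measurable N" for u a
    using that(1)
    by (cases a)
       (auto intro!: borel_measurable_times borel_measurable_prod borel_measurable_power
         assms(1) that(2))
  \<comment> \<open>Each iterate is a polynomial in the rate and in finitely many vector
    coordinates; the limit is then handled as a pointwise \<open>lim\<close> of measurable
    functions.\<close>
  have "(\<lambda>\<omega>. ?x n \<omega> a) \<in> borel_measurable N" if "valid_label t a" for n a
    using that by (induction n arbitrary: a) (simp_all add: var check)
  then have "(\<lambda>\<omega>. de_u_lim l r t (\<epsilon> \<omega>) (\<delta>L \<omega>) (\<delta>R \<omega>) a) \<in> borel_measurable N"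
    if "valid_label t a" for a
    unfolding de_u_lim_def de_u_def using that by (intro borel_measurable_lim_metric check)
  then show ?thesis
    unfolding erasure_prob_def Let_def using assms(1,4)
    by (intro borel_measurable_times borel_measurable_prod borel_measurable_power) auto
qed

lemma helper_chain_measurable:
  assumes "\<And>i. i \<in> {1..k} \<Longrightarrow> (\<lambda>\<omega>. e \<omega> i) \<in> borel_measurable N"
    and "\<And>i. i \<in> {1..t} \<Longrightarrow> (\<lambda>\<omega>. \<delta> \<omega> i) \<in> borel_measurable N"
    and "i \<in> {1..t}"
  shows "(\<lambda>\<omega>. helper_chain l r t k (e \<omega>) (\<delta> \<omega>) i) \<in> borel_measurable N"
  using assms
proof (induction k arbitrary: \<delta> i)
  case (Suc k)
  have "(\<lambda>\<omega>. helper_out l r t (e \<omega> (Suc k)) (\<delta> \<omega>) i) \<in> borel_measurable N" if "i \<in> {1..t}" for i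
    unfolding helper_out_eq using Suc.prems that
    by (intro borel_measurable_diff borel_measurable_prod borel_measurable_power
        erasure_prob_measurable) auto
  then show ?case
    unfolding helper_chain.simps using Suc.prems by (intro Suc.IH) auto
qed simp

lemma decodes_measurable:
  assumes "\<epsilon> \<in> borel_measurable N"
    and "\<And>i. i \<in> {1..t} \<Longrightarrow> (\<lambda>\<omega>. \<delta>\<^sub>1 \<omega> i) \<in> borel_measurable N"
    and "\<And>i. i \<in> {1..t} \<Longrightarrow> (\<lambda>\<omega>. \<delta>\<^sub>2 \<omega> i) \<in> borel_measurable N"
  shows "Measurable.pred N (\<lambda>\<omega>. decodes l r t (\<epsilon> \<omega>) (\<delta>\<^sub>1 \<omega>) (\<delta>\<^sub>2 \<omega>))"
proof -
  have rev: "(\<lambda>\<omega>. \<delta>\<^sub>1 \<omega> (t + 1 - i)) \<in> borel_measurable N" if "i \<in> {1..t}" for i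
    using that by (intro assms(2)) auto
  have [measurable]: "(\<lambda>\<omega>. erasure_prob l r t q (\<lambda>i. \<delta>\<^sub>1 \<omega> (t + 1 - i)) (\<delta>\<^sub>2 \<omega>) k) \<in> borel_measurable N"
    if "k \<in> {1..t + 1}" for q k
    using assms(1,3) that by (intro erasure_prob_measurable rev) auto
  have "countable (\<rat> \<inter> {0..1 :: real})"
    using countable_rat by blast
  note [measurable] = assms(1)
  have "Measurable.pred N (\<lambda>\<omega>. \<epsilon> \<omega> < q \<and>
      (\<forall>k\<in>{1..t + 1}. erasure_prob l r t q (\<lambda>i. \<delta>\<^sub>1 \<omega> (t + 1 - i)) (\<delta>\<^sub>2 \<omega>) k = 0))" for q
    by measurable
  then show ?thesis
    unfolding decodes_def pred_def
    by (intro sets.sets_Collect_countable_Ex'[OF _ \<open>countable _\<close>])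
qed

subsection \<open>Independent blocks\<close>

text \<open>The right-hand side does not mention \<open>\<pi>\<close>: any two injections of
  \<open>K\<close> into the index set give the same probability. This is used to reflect the blocks
  about the target and to move a chain of blocks to another place.\<close>

lemma (in prob_space) prob_iid_reindex:
  fixes X :: "'i \<Rightarrow> 'a \<Rightarrow> 'b" and \<pi> :: "'k \<Rightarrow> 'i"
  assumes ind: "indep_vars (\<lambda>_. N) X I" and D: "\<And>i. i \<in> I \<Longrightarrow> distr M N (X i) = D"
    and \<pi>: "inj_on \<pi> K" "\<pi> ` K \<subseteq> I" "K \<noteq> {}"
    and Q: "Measurable.pred (PiM K (\<lambda>_. N)) Q"
  shows "prob {\<omega> \<in> space M. Q (\<lambda>k\<in>K. X (\<pi> k) \<omega>)} =
    measure (PiM K (\<lambda>_. D)) {f \<in> space (PiM K (\<lambda>_. N)). Q f}"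
proof -
  have rv[measurable]: "random_variable N (X i)" if "i \<in> I" for i
    using ind that by (auto simp: indep_vars_def)
  obtain i where i: "i \<in> I" using \<pi> by blast
  interpret D: prob_space D
    using prob_space_distr[OF rv[OF i]] D[OF i] by simp
  have sD[measurable_cong]: "sets D = sets N" using D[OF i] by force
  have sP[measurable_cong]: "sets (PiM J (\<lambda>_. D)) = sets (PiM J (\<lambda>_. N))" for J :: "'j set"
    by (intro sets_PiM_cong refl sD)
  have mX: "(\<lambda>\<omega>. \<lambda>i\<in>I. X i \<omega>) \<in> measurable M (PiM I (\<lambda>_. N))"
    by (intro measurable_restrict rv)
  have m\<pi>: "(\<lambda>f. \<lambda>k\<in>K. f (\<pi> k)) \<in> measurable (PiM I (\<lambda>_. N)) (PiM K (\<lambda>_. D))"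
    using \<pi>(2) by (intro measurable_restrict) (auto simp: measurable_cong_sets[OF refl sD])
  have "distr M (PiM I (\<lambda>_. N)) (\<lambda>\<omega>. \<lambda>i\<in>I. X i \<omega>) = PiM I (\<lambda>i. distr M N (X i))"
    using ind i by (subst indep_vars_iff_distr_eq_PiM'[symmetric]) (auto intro: rv)
  also have "\<dots> = PiM I (\<lambda>_. D)"
    by (intro PiM_cong refl D)
  finally have law: "distr M (PiM I (\<lambda>_. N)) (\<lambda>\<omega>. \<lambda>i\<in>I. X i \<omega>) = PiM I (\<lambda>_. D)" .
  \<comment> \<open>A product of identical factors is reproduced when it is projected along an
    injective index map; composing with the joint law of the whole family gives the law of the
    reindexed family.\<close>
  have "PiM K (\<lambda>_. D) = distr (PiM I (\<lambda>_. D)) (PiM K (\<lambda>_. D)) (\<lambda>f. \<lambda>k\<in>K. f (\<pi> k))"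
    using \<pi> D.prob_space_axioms by (intro distr_PiM_reindex[symmetric]) auto
  also have "\<dots> = distr M (PiM K (\<lambda>_. D)) ((\<lambda>f. \<lambda>k\<in>K. f (\<pi> k)) \<circ> (\<lambda>\<omega>. \<lambda>i\<in>I. X i \<omega>))"
    unfolding law[symmetric] by (rule distr_distr[OF m\<pi>[unfolded law] mX])
  also have "(\<lambda>f. \<lambda>k\<in>K. f (\<pi> k)) \<circ> (\<lambda>\<omega>. \<lambda>i\<in>I. X i \<omega>) = (\<lambda>\<omega>. \<lambda>k\<in>K. X (\<pi> k) \<omega>)"
    using \<pi>(2) by (auto simp: fun_eq_iff restrict_def)
  finally have eq: "PiM K (\<lambda>_. D) = distr M (PiM K (\<lambda>_. D)) (\<lambda>\<omega>. \<lambda>k\<in>K. X (\<pi> k) \<omega>)" .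
  have mK: "(\<lambda>\<omega>. \<lambda>k\<in>K. X (\<pi> k) \<omega>) \<in> measurable M (PiM K (\<lambda>_. D))"
    using \<pi>(2) by (intro measurable_restrict) (auto simp: measurable_cong_sets[OF refl sD] intro: rv)
  have sp: "space (PiM K (\<lambda>_. N)) = space (PiM K (\<lambda>_. D))"
    by (rule sets_eq_imp_space_eq[OF sP, symmetric])
  have "{f \<in> space (PiM K (\<lambda>_. D)). Q f} \<in> sets (PiM K (\<lambda>_. D))"
    using Q unfolding pred_def sP sp .
  then have "measure (PiM K (\<lambda>_. D)) {f \<in> space (PiM K (\<lambda>_. D)). Q f} =
      prob ((\<lambda>\<omega>. \<lambda>k\<in>K. X (\<pi> k) \<omega>) -` {f \<in> space (PiM K (\<lambda>_. D)). Q f} \<inter> space M)"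
    by (subst eq) (rule measure_distr[OF mK])
  also have "(\<lambda>\<omega>. \<lambda>k\<in>K. X (\<pi> k) \<omega>) -` {f \<in> space (PiM K (\<lambda>_. D)). Q f} \<inter> space M =
      {\<omega> \<in> space M. Q (\<lambda>k\<in>K. X (\<pi> k) \<omega>)}"
    using measurable_space[OF mK] by auto
  finally show ?thesis by (simp add: sp)
qed

lemma (in prob_space) indep_three_blocks:
  fixes X :: "'i \<Rightarrow> 'a \<Rightarrow> 'b"
  assumes ind: "indep_vars (\<lambda>_. N) X I"
    and K: "K1 \<subseteq> I" "K2 \<subseteq> I" "K3 \<subseteq> I" "K1 \<inter> K2 = {}" "K1 \<inter> K3 = {}" "K2 \<inter> K3 = {}"
    and Q: "Measurable.pred (PiM K1 (\<lambda>_. N)) Q1" "Measurable.pred (PiM K2 (\<lambda>_. N)) Q2"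
      "Measurable.pred (PiM K3 (\<lambda>_. N)) Q3"
  shows "prob {\<omega> \<in> space M. Q1 (\<lambda>k\<in>K1. X k \<omega>) \<and> Q2 (\<lambda>k\<in>K2. X k \<omega>) \<and> Q3 (\<lambda>k\<in>K3. X k \<omega>)} =
    prob {\<omega> \<in> space M. Q1 (\<lambda>k\<in>K1. X k \<omega>)} * prob {\<omega> \<in> space M. Q2 (\<lambda>k\<in>K2. X k \<omega>)} *
    prob {\<omega> \<in> space M. Q3 (\<lambda>k\<in>K3. X k \<omega>)}"
proof -
  \<comment> \<open>List lookup turns the three blocks into a family indexed by
    \<open>0, 1, 2\<close>, the form in which grouping of independent variables is
    available.\<close>
  define K where "K = (!) [K1, K2, K3]"
  define Q where "Q = (!) [Q1, Q2, Q3]"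
  define A where "A n = {f \<in> space (PiM (K n) (\<lambda>_. N)). Q n f}" for n
  define Y where "Y n \<omega> = (\<lambda>k\<in>K n. X k \<omega>)" for n \<omega>
  let ?L = "{0, 1, 2 :: nat}"
  have "indep_vars (\<lambda>n. PiM (K n) (\<lambda>_. N)) Y ?L"
    unfolding Y_def using K
    by (intro indep_vars_restrict[OF ind]) (auto simp: K_def disjoint_family_on_def)
  moreover have "A n \<in> sets (PiM (K n) (\<lambda>_. N))" if "n \<in> ?L" for n
    using that Q unfolding A_def pred_def by (auto simp: K_def Q_def)
  ultimately have "prob (\<Inter>n\<in>?L. Y n -` A n \<inter> space M) = (\<Prod>n\<in>?L. prob (Y n -` A n \<inter> space M))"
    by (intro indep_varsD_finite) auto
  moreover have Y: "Y n -` A n \<inter> space M = {\<omega> \<in> space M. Q n (\<lambda>k\<in>K n. X k \<omega>)}" if "n \<in> ?L" for n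
  proof -
    have "X k \<in> measurable M N" if "k \<in> I" for k
      using ind that by (auto simp: indep_vars_def)
    then have "Y n \<in> measurable M (PiM (K n) (\<lambda>_. N))"
      unfolding Y_def using K \<open>n \<in> ?L\<close> by (intro measurable_restrict) (auto simp: K_def)
    from measurable_space[OF this] show ?thesis
      by (auto simp: A_def Y_def)
  qed
  moreover have "(\<Inter>n\<in>?L. Y n -` A n \<inter> space M) =
      {\<omega> \<in> space M. Q1 (\<lambda>k\<in>K1. X k \<omega>) \<and> Q2 (\<lambda>k\<in>K2. X k \<omega>) \<and> Q3 (\<lambda>k\<in>K3. X k \<omega>)}"
    by (subst INF_cong[OF refl Y]) (auto simp: K_def Q_def)
  ultimately show ?thesis
    by (simp add: K_def Q_def mult.assoc)
qed

text \<open>Common core of both bounds, by total probability. \<open>Q1\<close> and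
  \<open>Q2\<close> are two independent switches, and \<open>Q3 a b\<close> is a condition on a
  third block that forces success \<open>S\<close> when the switches show \<open>a\<close> and
  \<open>b\<close>. Success may also occur otherwise, which is why only an inequality
  results.\<close>

lemma (in prob_space) prob_ge_two_switches:
  fixes X :: "'i \<Rightarrow> 'a \<Rightarrow> 'b"
  assumes ind: "indep_vars (\<lambda>_. N) X I"
    and K: "K1 \<subseteq> I" "K2 \<subseteq> I" "K3 \<subseteq> I" "K1 \<inter> K2 = {}" "K1 \<inter> K3 = {}" "K2 \<inter> K3 = {}"
    and Q: "Measurable.pred (PiM K1 (\<lambda>_. N)) Q1" "Measurable.pred (PiM K2 (\<lambda>_. N)) Q2"
      "\<And>a b. Measurable.pred (PiM K3 (\<lambda>_. N)) (Q3 a b)"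
    and S: "{\<omega> \<in> space M. S \<omega>} \<in> events"
    and imp: "\<And>\<omega>. \<omega> \<in> space M \<Longrightarrow>
      Q3 (Q1 (\<lambda>k\<in>K1. X k \<omega>)) (Q2 (\<lambda>k\<in>K2. X k \<omega>)) (\<lambda>k\<in>K3. X k \<omega>) \<Longrightarrow> S \<omega>"
    and p: "prob {\<omega> \<in> space M. Q1 (\<lambda>k\<in>K1. X k \<omega>)} = p1"
      "prob {\<omega> \<in> space M. Q2 (\<lambda>k\<in>K2. X k \<omega>)} = p2"
      "\<And>a b. prob {\<omega> \<in> space M. Q3 a b (\<lambda>k\<in>K3. X k \<omega>)} = c a b"
  shows "p1 * p2 * c True True + p1 * (1 - p2) * c True False + (1 - p1) * p2 * c False True
      + (1 - p1) * (1 - p2) * c False False \<le> prob {\<omega> \<in> space M. S \<omega>}"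
proof -
  define F where "F = (\<lambda>(a, b). {\<omega> \<in> space M. (Q1 (\<lambda>k\<in>K1. X k \<omega>) = a) \<and>
    (Q2 (\<lambda>k\<in>K2. X k \<omega>) = b) \<and> Q3 a b (\<lambda>k\<in>K3. X k \<omega>)})"
  have rv: "X k \<in> measurable M N" if "k \<in> I" for k
    using ind that by (auto simp: indep_vars_def)
  have [measurable]: "(\<lambda>\<omega>. \<lambda>k\<in>K1. X k \<omega>) \<in> measurable M (PiM K1 (\<lambda>_. N))"
    "(\<lambda>\<omega>. \<lambda>k\<in>K2. X k \<omega>) \<in> measurable M (PiM K2 (\<lambda>_. N))"
    "(\<lambda>\<omega>. \<lambda>k\<in>K3. X k \<omega>) \<in> measurable M (PiM K3 (\<lambda>_. N))"
    using K by (auto intro!: measurable_restrict rv)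
  note [measurable] = Q
  have neg: "prob {\<omega> \<in> space M. Q1 (\<lambda>k\<in>K1. X k \<omega>) = a} = (if a then p1 else 1 - p1)"
    "prob {\<omega> \<in> space M. Q2 (\<lambda>k\<in>K2. X k \<omega>) = a} = (if a then p2 else 1 - p2)" for a
    unfolding p(1,2)[symmetric] by (cases a; simp add: prob_neg)+
  have Feq: "prob (F (a, b)) = (if a then p1 else 1 - p1) * (if b then p2 else 1 - p2) * c a b" for a b
    unfolding F_def case_prod_conv neg[symmetric] p(3)[symmetric]
    by (intro indep_three_blocks[OF ind K]) (use Q in measurable)
  have "(\<Sum>x\<in>UNIV. prob (F x)) = prob (\<Union>x. F x)"
    by (intro finite_measure_finite_Union[symmetric])
       (auto simp: F_def disjoint_family_on_def split: prod.splits)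
  also have "\<dots> \<le> prob {\<omega> \<in> space M. S \<omega>}"
    using imp by (intro finite_measure_mono S) (auto simp: F_def)
  finally show ?thesis
    unfolding UNIV_Times_UNIV[symmetric]
    by (simp add: sum.cartesian_product[symmetric] UNIV_bool Feq algebra_simps del: UNIV_Times_UNIV)
qed

subsection \<open>Success events\<close>

text \<open>A predicate on the family of block rates instead of on outcomes, so that it can be
  evaluated on product spaces and on families restricted to a block of indices.\<close>

definition two_sided_decodes ::
  "nat \<Rightarrow> nat \<Rightarrow> nat \<Rightarrow> nat \<Rightarrow> (nat \<Rightarrow> real) \<Rightarrow> (nat \<Rightarrow> real) \<Rightarrow> (int \<Rightarrow> real) \<Rightarrow> bool" where
  "two_sided_decodes l r t k \<delta>\<^sub>1 \<delta>\<^sub>2 f \<longleftrightarrow>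
     decodes l r t (f 0) (helper_chain l r t k (\<lambda>i. f (- int i)) \<delta>\<^sub>1) (helper_chain l r t k (\<lambda>i. f (int i)) \<delta>\<^sub>2)"

definition one_sided_decodes ::
  "nat \<Rightarrow> nat \<Rightarrow> nat \<Rightarrow> nat \<Rightarrow> (nat \<Rightarrow> real) \<Rightarrow> (nat \<Rightarrow> real) \<Rightarrow> bool" where
  "one_sided_decodes l r t k \<delta> f \<longleftrightarrow> decodes l r t (f 0) (\<lambda>_. 1) (helper_chain l r t k f \<delta>)"

text \<open>The product-space results present families restricted to an index set and
  \<open>undefined\<close> elsewhere; this congruence lets the restriction be dropped.\<close>

lemma two_sided_decodes_cong:
  assumes "\<And>i. i \<in> {- int k..int k} \<Longrightarrow> f i = g i"
  shows "two_sided_decodes l r t k \<delta>\<^sub>1 \<delta>\<^sub>2 f = two_sided_decodes l r t k \<delta>\<^sub>1 \<delta>\<^sub>2 g"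
proof -
  have "helper_chain l r t k (\<lambda>i. f (- int i)) \<delta>\<^sub>1 = helper_chain l r t k (\<lambda>i. g (- int i)) \<delta>\<^sub>1"
    "helper_chain l r t k (\<lambda>i. f (int i)) \<delta>\<^sub>2 = helper_chain l r t k (\<lambda>i. g (int i)) \<delta>\<^sub>2"
    using assms by (intro helper_chain_cong; auto)+
  then show ?thesis
    using assms[of 0] by (simp add: two_sided_decodes_def)
qed

lemma one_sided_decodes_cong:
  assumes "\<And>i. i \<le> k \<Longrightarrow> f i = g i"
  shows "one_sided_decodes l r t k \<delta> f = one_sided_decodes l r t k \<delta> g"
  using assms helper_chain_cong[of k f g l r t \<delta>] by (simp add: one_sided_decodes_def)

text \<open>Serves for two choices of \<open>e\<close>: the given process on \<open>M\<close>, and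
  the identity on a product space of real lines.\<close>

lemma two_sided_decodes_measurable:
  assumes "\<And>i. i \<in> {- int k..int k} \<Longrightarrow> (\<lambda>\<omega>. e \<omega> i) \<in> borel_measurable N"
  shows "Measurable.pred N (\<lambda>\<omega>. two_sided_decodes l r t k \<delta>\<^sub>1 \<delta>\<^sub>2 (e \<omega>))"
  unfolding two_sided_decodes_def
  by (intro decodes_measurable helper_chain_measurable assms) auto

lemma one_sided_decodes_measurable:
  assumes "\<And>i. i \<le> k \<Longrightarrow> (\<lambda>\<omega>. e \<omega> i) \<in> borel_measurable N"
  shows "Measurable.pred N (\<lambda>\<omega>. one_sided_decodes l r t k \<delta> (e \<omega>))"
  unfolding one_sided_decodes_def
  by (intro decodes_measurable helper_chain_measurable assms) auto

lemma two_sided_success_eq: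
  assumes "\<And>k \<omega>. k \<in> {- int n..int n} \<Longrightarrow> \<omega> \<in> space M \<Longrightarrow> E k \<omega> \<in> {0..1}"
    and "j div 2 \<le> n" "unit_box t \<delta>\<^sub>1" "unit_box t \<delta>\<^sub>2"
  shows "two_sided_success l r t M E j \<delta>\<^sub>1 \<delta>\<^sub>2 =
    measure M {\<omega> \<in> space M. two_sided_decodes l r t (j div 2) \<delta>\<^sub>1 \<delta>\<^sub>2 (\<lambda>k. E k \<omega>)}"
  unfolding two_sided_success_def two_sided_decodes_def
proof (intro arg_cong[where f = "measure M"] Collect_cong conj_cong refl less_eps_star_iff_decodes
    helper_chain_unit assms(3,4))
  fix \<omega> assume \<omega>: "\<omega> \<in> space M"
  show "0 \<le> E 0 \<omega>" using assms(1)[of 0 \<omega>] \<omega> by simp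
  show "E (- int i) \<omega> \<in> {0..1}" "E (int i) \<omega> \<in> {0..1}" if "i \<in> {1..j div 2}" for i
    using that assms(2) \<omega> by (intro assms(1); auto)+
qed

lemma one_sided_success_eq:
  assumes "\<And>k \<omega>. k \<in> {- int n..int n} \<Longrightarrow> \<omega> \<in> space M \<Longrightarrow> E k \<omega> \<in> {0..1}"
    and "j \<le> n" "unit_box t \<delta>"
  shows "one_sided_success l r t M E j \<delta> =
    measure M {\<omega> \<in> space M. one_sided_decodes l r t j \<delta> (\<lambda>k. E (int k) \<omega>)}"
  unfolding one_sided_success_def one_sided_decodes_def of_nat_0
proof (intro arg_cong[where f = "measure M"] Collect_cong conj_cong refl less_eps_star_iff_decodes
    helper_chain_unit assms(3) unit_box_const)
  fix \<omega> assume \<omega>: "\<omega> \<in> space M"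
  show "0 \<le> E 0 \<omega>" using assms(1)[of 0 \<omega>] \<omega> by simp
  show "E (int i) \<omega> \<in> {0..1}" if "i \<in> {1..j}" for i
    using that assms(2) \<omega> by (intro assms(1)) auto
qed

text \<open>Depending on a truth value lets a single formula cover all four success patterns, with
  the flag itself random.\<close>

definition flag_vec :: "bool \<Rightarrow> nat \<Rightarrow> real" where
  "flag_vec b = (\<lambda>_. if b then 0 else 1)"

lemma unit_box_flag_vec [simp]: "unit_box t (flag_vec b)"
  by (simp add: flag_vec_def unit_box_def)

lemma helper_out_le_flag_vec:
  assumes "\<epsilon> \<in> {0..1}" "unit_box t \<delta>"
  shows "box_le t (helper_out l r t \<epsilon> \<delta>) (flag_vec (decodes l r t \<epsilon> (\<lambda>_. 1) \<delta>))"
proof (cases "decodes l r t \<epsilon> (\<lambda>_. 1) \<delta>")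
  case True
  then show ?thesis
    using helper_out_decoded[OF True] assms by (simp add: box_le_def flag_vec_def)
next
  case False
  then show ?thesis
    using box_le_one[OF helper_out_unit[OF assms]] by (simp add: flag_vec_def)
qed

section \<open>The two bounds on the success probability\<close>

theorem proposition1:
  fixes l r t j :: nat
    and M :: "'a measure" and E :: "int \<Rightarrow> 'a \<Rightarrow> real" and D :: "real measure"
    and P_L P_S P_D :: real
  assumes "3 \<le> l" and "l < r" and "1 \<le> t" and "t \<le> l - 2" and "(t + 1) dvd r"
    and "even j" and "2 \<le> j"
    and "prob_space M"
    and "prob_space.indep_vars M (\<lambda>_. borel) E {- int (j div 2)..int (j div 2)}"
    and "\<And>k. k \<in> {- int (j div 2)..int (j div 2)} \<Longrightarrow> distr M borel (E k) = D"
    and "\<And>k \<omega>. k \<in> {- int (j div 2)..int (j div 2)} \<Longrightarrow> \<omega> \<in> space M \<Longrightarrow> E k \<omega> \<in> {0..1}"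
    and "P_L = measure D {e. e < eps_star l r t (\<lambda>_. 1) (\<lambda>_. 1)}"
    and "P_S = measure D {e. e < eps_star l r t (\<lambda>_. 1) (\<lambda>_. 0)}"
    and "P_D = measure D {e. e < eps_star l r t (\<lambda>_. 0) (\<lambda>_. 0)}"
  shows "two_sided_success l r t M E j (\<lambda>_. 1) (\<lambda>_. 1)
           \<ge> P_L\<^sup>2 * two_sided_success l r t M E (j - 2) (\<lambda>_. 0) (\<lambda>_. 0)
             + 2 * P_L * (1 - P_L) * two_sided_success l r t M E (j - 2) (\<lambda>_. 1) (\<lambda>_. 0)
             + (1 - P_L)\<^sup>2 * two_sided_success l r t M E (j - 2) (\<lambda>_. 1) (\<lambda>_. 1)
         \<and> (\<forall>\<delta>\<^sub>1 \<delta>\<^sub>2. (\<forall>i\<in>{1..t}. \<delta>\<^sub>1 i \<in> {0..1}) \<longrightarrow> (\<forall>i\<in>{1..t}. \<delta>\<^sub>2 i \<in> {0..1}) \<longrightarrow>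
           (let p = two_sided_success l r t M E j \<delta>\<^sub>1 \<delta>\<^sub>2;
                p1 = one_sided_success l r t M E (j div 2 - 1) \<delta>\<^sub>1;
                p2 = one_sided_success l r t M E (j div 2 - 1) \<delta>\<^sub>2
            in p \<ge> P_L * (1 - p1) * (1 - p2)
                   + P_S * (p2 * (1 - p1) + p1 * (1 - p2))
                   + P_D * p1 * p2))"
proof -
  \<comment> \<open>\<open>m\<close> is the number of helpers left on each side once one per side
    has been split off.\<close>
  define m where "m = j div 2 - 1"
  have j2: "j div 2 = Suc m" "(j - 2) div 2 = m" "j div 2 - 1 = m"
    using assms(6,7) by (auto simp: m_def)
  let ?I = "{- int (Suc m)..int (Suc m)}"
  interpret prob_space M by fact
  have ind: "indep_vars (\<lambda>_. borel) E ?I"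
    and D: "\<And>k. k \<in> ?I \<Longrightarrow> distr M borel (E k) = D"
    and E: "\<And>k \<omega>. k \<in> ?I \<Longrightarrow> \<omega> \<in> space M \<Longrightarrow> E k \<omega> \<in> {0..1}"
    using assms(9-11) unfolding j2 by blast+
  have rv: "E k \<in> borel_measurable M" if "k \<in> ?I" for k
    using ind that by (auto simp: indep_vars_def)
  have comp: "(\<lambda>f. f k) \<in> borel_measurable (PiM K (\<lambda>_. borel))" if "k \<in> K" for k :: 'i and K
    using that by (rule measurable_component_singleton)
  have two_eq: "two_sided_success l r t M E i \<delta>\<^sub>1 \<delta>\<^sub>2 =
      prob {\<omega> \<in> space M. two_sided_decodes l r t (i div 2) \<delta>\<^sub>1 \<delta>\<^sub>2 (\<lambda>k. E k \<omega>)}"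
    if "i div 2 \<le> Suc m" "unit_box t \<delta>\<^sub>1" "unit_box t \<delta>\<^sub>2" for i \<delta>\<^sub>1 \<delta>\<^sub>2
    using E that by (rule two_sided_success_eq)
  have one_eq: "one_sided_success l r t M E m \<delta> =
      prob {\<omega> \<in> space M. one_sided_decodes l r t m \<delta> (\<lambda>k. E (int k) \<omega>)}"
    if "unit_box t \<delta>" for \<delta>
    by (rule one_sided_success_eq[where n = "Suc m", OF E _ that]) simp_all
  \<comment> \<open>The equivalence with \<open>decodes\<close> is available for nonnegative rates
    only, so the event under \<open>D\<close> is pulled back along \<open>E k\<close>, whose values
    lie in the unit interval. Any block \<open>k\<close> may be used, since all have law
    \<open>D\<close>.\<close>
  have less_c: "measure D {e. e < eps_star l r t \<delta>\<^sub>1 \<delta>\<^sub>2} =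
      prob {\<omega> \<in> space M. decodes l r t (E k \<omega>) \<delta>\<^sub>1 \<delta>\<^sub>2}"
    if "k \<in> ?I" "unit_box t \<delta>\<^sub>1" "unit_box t \<delta>\<^sub>2" for k \<delta>\<^sub>1 \<delta>\<^sub>2
  proof -
    have "measure D {e. e < eps_star l r t \<delta>\<^sub>1 \<delta>\<^sub>2} =
        prob (E k -` {e. e < eps_star l r t \<delta>\<^sub>1 \<delta>\<^sub>2} \<inter> space M)"
      unfolding D[OF that(1), symmetric] by (rule measure_distr[OF rv[OF that(1)]]) simp
    also have "E k -` {e. e < eps_star l r t \<delta>\<^sub>1 \<delta>\<^sub>2} \<inter> space M =
        {\<omega> \<in> space M. decodes l r t (E k \<omega>) \<delta>\<^sub>1 \<delta>\<^sub>2}"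
      using less_eps_star_iff_decodes[OF _ that(2,3)] E[OF that(1)] by auto
    finally show ?thesis .
  qed
  have P_L: "prob {\<omega> \<in> space M. decodes l r t (E k \<omega>) (\<lambda>_. 1) (\<lambda>_. 1)} = P_L" if "k \<in> ?I" for k
    using less_c[OF that] assms(12) by simp
  have commute: "decodes l r t \<epsilon> \<delta>\<^sub>1 \<delta>\<^sub>2 \<longleftrightarrow> decodes l r t \<epsilon> \<delta>\<^sub>2 \<delta>\<^sub>1" for \<epsilon> \<delta>\<^sub>1 \<delta>\<^sub>2
    using decodes_commute[OF assms(5)] by blast
  have two_Suc_sets: "{\<omega> \<in> space M. two_sided_decodes l r t (Suc m) \<delta>\<^sub>1 \<delta>\<^sub>2 (\<lambda>k. E k \<omega>)} \<in> events" for \<delta>\<^sub>1 \<delta>\<^sub>2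
    using two_sided_decodes_measurable[where e = "\<lambda>\<omega> k. E k \<omega>", OF rv] by (simp only: pred_def)

  have farthest: "P_L\<^sup>2 * two_sided_success l r t M E (j - 2) (\<lambda>_. 0) (\<lambda>_. 0)
      + 2 * P_L * (1 - P_L) * two_sided_success l r t M E (j - 2) (\<lambda>_. 1) (\<lambda>_. 0)
      + (1 - P_L)\<^sup>2 * two_sided_success l r t M E (j - 2) (\<lambda>_. 1) (\<lambda>_. 1)
      \<le> two_sided_success l r t M E j (\<lambda>_. 1) (\<lambda>_. 1)"
  proof -
    let ?K = "{- int m..int m}"
    let ?far = "\<lambda>k f. decodes l r t (f k) (\<lambda>_. 1) (\<lambda>_. 1)"
    define c where "c a b = two_sided_success l r t M E (j - 2) (flag_vec a) (flag_vec b)" for a b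
    have restr: "two_sided_decodes l r t m \<delta>\<^sub>1 \<delta>\<^sub>2 (\<lambda>k\<in>?K. E k \<omega>) =
        two_sided_decodes l r t m \<delta>\<^sub>1 \<delta>\<^sub>2 (\<lambda>k. E k \<omega>)" for \<delta>\<^sub>1 \<delta>\<^sub>2 \<omega>
      by (rule two_sided_decodes_cong) auto
    have c_eq: "prob {\<omega> \<in> space M. two_sided_decodes l r t m (flag_vec a) (flag_vec b) (\<lambda>k\<in>?K. E k \<omega>)} = c a b"
      for a b
      using two_eq[of "j - 2"] by (simp add: restr c_def j2)
    \<comment> \<open>Swapping the two vectors amounts to reflecting the inner blocks about the
      target. For a fixed outcome this changes the rates, so equality holds only between
      probabilities: the i.i.d. law is reindexed by \<open>uminus\<close> and combined with the
      symmetry of \<open>decodes\<close>.\<close>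
    have c_sym: "c False True = c True False"
    proof -
      have meas: "Measurable.pred (PiM ?K (\<lambda>_. borel)) (two_sided_decodes l r t m \<delta>\<^sub>1 \<delta>\<^sub>2)" for \<delta>\<^sub>1 \<delta>\<^sub>2
        using two_sided_decodes_measurable[where e = "\<lambda>f. f", OF comp] by blast
      have refl': "two_sided_decodes l r t m \<delta>\<^sub>1 \<delta>\<^sub>2 (\<lambda>k\<in>?K. E (- k) \<omega>) =
          two_sided_decodes l r t m \<delta>\<^sub>2 \<delta>\<^sub>1 (\<lambda>k\<in>?K. E k \<omega>)" for \<delta>\<^sub>1 \<delta>\<^sub>2 \<omega>
      proof -
        have "two_sided_decodes l r t m \<delta>\<^sub>1 \<delta>\<^sub>2 (\<lambda>k\<in>?K. E (- k) \<omega>) =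
            two_sided_decodes l r t m \<delta>\<^sub>1 \<delta>\<^sub>2 (\<lambda>k. E (- k) \<omega>)"
          by (rule two_sided_decodes_cong) auto
        then show ?thesis
          unfolding restr by (simp add: two_sided_decodes_def commute)
      qed
      have "c a b = c b a" for a b
        using prob_iid_reindex[OF ind D _ _ _ meas, of "\<lambda>k. k" "flag_vec a" "flag_vec b"]
          prob_iid_reindex[OF ind D _ _ _ meas, of uminus "flag_vec a" "flag_vec b"]
        by (simp add: refl' c_eq[symmetric])
      then show ?thesis .
    qed
    \<comment> \<open>The switches are the two outermost blocks alone. With 1 entering from outside
      they must decode unaided, with probability \<open>P_L\<close> each; the third block holds the
      target and the \<open>m\<close> inner helpers per side.\<close>
    have "P_L * P_L * c True True + P_L * (1 - P_L) * c True False + (1 - P_L) * P_L * c False True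
        + (1 - P_L) * (1 - P_L) * c False False
        \<le> prob {\<omega> \<in> space M. two_sided_decodes l r t (Suc m) (\<lambda>_. 1) (\<lambda>_. 1) (\<lambda>k. E k \<omega>)}"
    proof (rule prob_ge_two_switches[OF ind, where ?K1.0 = "{- int (Suc m)}" and ?K2.0 = "{int (Suc m)}"
          and ?K3.0 = ?K and ?Q1.0 = "?far (- int (Suc m))" and ?Q2.0 = "?far (int (Suc m))"
          and ?Q3.0 = "\<lambda>a b. two_sided_decodes l r t m (flag_vec a) (flag_vec b)"])
      fix \<omega> assume \<omega>: "\<omega> \<in> space M"
      let ?far' = "\<lambda>k. flag_vec (decodes l r t (E k \<omega>) (\<lambda>_. 1) (\<lambda>_. 1))"
      assume "two_sided_decodes l r t m
          (flag_vec (?far (- int (Suc m)) (\<lambda>k\<in>{- int (Suc m)}. E k \<omega>)))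
          (flag_vec (?far (int (Suc m)) (\<lambda>k\<in>{int (Suc m)}. E k \<omega>))) (\<lambda>k\<in>?K. E k \<omega>)"
      then have dec: "decodes l r t (E 0 \<omega>)
          (helper_chain l r t m (\<lambda>i. E (- int i) \<omega>) (?far' (- int (Suc m))))
          (helper_chain l r t m (\<lambda>i. E (int i) \<omega>) (?far' (int (Suc m))))"
        unfolding restr unfolding two_sided_decodes_def by simp
      \<comment> \<open>The map \<sigma> sends a distance to the position of the helper there, so
        that both sides are treated at once.\<close>
      have out: "box_le t (helper_chain l r t (Suc m) (\<lambda>i. E (\<sigma> i) \<omega>) (\<lambda>_. 1))
            (helper_chain l r t m (\<lambda>i. E (\<sigma> i) \<omega>) (?far' (\<sigma> (Suc m))))"
          "unit_box t (helper_chain l r t (Suc m) (\<lambda>i. E (\<sigma> i) \<omega>) (\<lambda>_. 1))"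
          "unit_box t (helper_chain l r t m (\<lambda>i. E (\<sigma> i) \<omega>) (?far' (\<sigma> (Suc m))))"
        if \<sigma>: "\<And>i. i \<in> {1..Suc m} \<Longrightarrow> \<sigma> i \<in> ?I" for \<sigma>
      proof -
        have E': "E (\<sigma> i) \<omega> \<in> {0..1}" if "i \<in> {1..Suc m}" for i
          using E[OF \<sigma>[OF that] \<omega>] .
        show "unit_box t (helper_chain l r t (Suc m) (\<lambda>i. E (\<sigma> i) \<omega>) (\<lambda>_. 1))"
          by (intro helper_chain_unit E' unit_box_const)
        show "unit_box t (helper_chain l r t m (\<lambda>i. E (\<sigma> i) \<omega>) (?far' (\<sigma> (Suc m))))"
          by (intro helper_chain_unit E' unit_box_flag_vec) auto
        show "box_le t (helper_chain l r t (Suc m) (\<lambda>i. E (\<sigma> i) \<omega>) (\<lambda>_. 1))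
            (helper_chain l r t m (\<lambda>i. E (\<sigma> i) \<omega>) (?far' (\<sigma> (Suc m))))"
          unfolding helper_chain.simps
          by (intro helper_chain_mono helper_out_unit helper_out_le_flag_vec E'
              unit_box_const unit_box_flag_vec) auto
      qed
      show "two_sided_decodes l r t (Suc m) (\<lambda>_. 1) (\<lambda>_. 1) (\<lambda>k. E k \<omega>)"
        unfolding two_sided_decodes_def
        by (rule decodes_antimono[OF dec]) (intro out; auto)+
    qed (auto simp: P_L intro!: two_Suc_sets c_eq decodes_measurable comp two_sided_decodes_measurable)
    also have "\<dots> = two_sided_success l r t M E j (\<lambda>_. 1) (\<lambda>_. 1)"
      using two_eq[of j] by (simp add: j2)
    \<comment> \<open>\<open>flag_vec False\<close> is the all-one vector, so
      \<open>c False True\<close> is the value at the pair (1, 0) that occurs in the claim; the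
      rewrite is oriented towards it.\<close>
    finally show ?thesis
      unfolding c_sym[symmetric] by (simp add: c_def flag_vec_def power2_eq_square algebra_simps)
  qed
  have nearest: "P_L * (1 - p1) * (1 - p2) + P_S * (p2 * (1 - p1) + p1 * (1 - p2)) + P_D * p1 * p2
      \<le> two_sided_success l r t M E j \<delta>\<^sub>1 \<delta>\<^sub>2"
    if box: "unit_box t \<delta>\<^sub>1" "unit_box t \<delta>\<^sub>2"
      and p: "p1 = one_sided_success l r t M E m \<delta>\<^sub>1" "p2 = one_sided_success l r t M E m \<delta>\<^sub>2"
    for \<delta>\<^sub>1 \<delta>\<^sub>2 p1 p2
  proof -
    let ?K1 = "{- int (Suc m)..-1}" and ?K2 = "{1..int (Suc m)}"
    let ?near = "\<lambda>\<sigma> \<delta> f. one_sided_decodes l r t m \<delta> (\<lambda>i. f (\<sigma> i :: int))"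
    \<comment> \<open>Index \<open>0\<close> lands on position \<open>-1\<close> or
      \<open>1\<close>: the nearest helper takes the role of the target of a one-sided problem, with
      the \<open>m\<close> blocks behind it as its helpers.\<close>
    let ?left = "\<lambda>i. - int (Suc i)" and ?right = "\<lambda>i. int (Suc i)"
    define c where "c a b = prob {\<omega> \<in> space M. decodes l r t (E 0 \<omega>) (flag_vec a) (flag_vec b)}" for a b
    \<comment> \<open>The one-sided probability refers to positions \<open>0..m\<close>; exchanging
      these for the positions under \<sigma> leaves it unchanged because the family is
      i.i.d.\<close>
    have shift: "prob {\<omega> \<in> space M. ?near \<sigma> \<delta> (\<lambda>k\<in>K. E k \<omega>)} = one_sided_success l r t M E m \<delta>"
      if \<sigma>: "inj \<sigma>" "\<sigma> ` {..m} \<subseteq> ?I" "\<sigma> ` {..m} \<subseteq> K" and \<delta>: "unit_box t \<delta>" for \<sigma> K \<delta>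
    proof -
      have meas: "Measurable.pred (PiM {..m} (\<lambda>_. borel)) (one_sided_decodes l r t m \<delta>)"
        using one_sided_decodes_measurable[where e = "\<lambda>f. f", OF comp] by auto
      have near: "?near \<sigma> \<delta> (\<lambda>k\<in>K. E k \<omega>) = one_sided_decodes l r t m \<delta> (\<lambda>i\<in>{..m}. E (\<sigma> i) \<omega>)" for \<omega>
        using \<sigma>(3) by (intro one_sided_decodes_cong) auto
      have target: "one_sided_decodes l r t m \<delta> (\<lambda>i. E (int i) \<omega>) =
          one_sided_decodes l r t m \<delta> (\<lambda>i\<in>{..m}. E (int i) \<omega>)" for \<omega>
        by (intro one_sided_decodes_cong) auto
      have "int ` {..m} \<subseteq> ?I" by auto
      then have "prob {\<omega> \<in> space M. one_sided_decodes l r t m \<delta> (\<lambda>i\<in>{..m}. E (\<sigma> i) \<omega>)} =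
          prob {\<omega> \<in> space M. one_sided_decodes l r t m \<delta> (\<lambda>i\<in>{..m}. E (int i) \<omega>)}"
        using prob_iid_reindex[OF ind D _ _ _ meas, of \<sigma>] prob_iid_reindex[OF ind D _ _ _ meas, of int]
          \<sigma>(1,2) by (auto simp: inj_on_def)
      then show ?thesis
        unfolding near one_eq[OF \<delta>] target .
    qed
    have "p1 * p2 * c True True + p1 * (1 - p2) * c True False + (1 - p1) * p2 * c False True
        + (1 - p1) * (1 - p2) * c False False
        \<le> prob {\<omega> \<in> space M. two_sided_decodes l r t (Suc m) \<delta>\<^sub>1 \<delta>\<^sub>2 (\<lambda>k. E k \<omega>)}"
    proof (rule prob_ge_two_switches[OF ind, where ?K1.0 = ?K1 and ?K2.0 = ?K2 and ?K3.0 = "{0}"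
          and ?Q1.0 = "?near ?left \<delta>\<^sub>1" and ?Q2.0 = "?near ?right \<delta>\<^sub>2"
          and ?Q3.0 = "\<lambda>a b f. decodes l r t (f 0) (flag_vec a) (flag_vec b)"])
      show "prob {\<omega> \<in> space M. ?near ?left \<delta>\<^sub>1 (\<lambda>k\<in>?K1. E k \<omega>)} = p1"
        unfolding p by (intro shift box) (auto simp: inj_def)
      show "prob {\<omega> \<in> space M. ?near ?right \<delta>\<^sub>2 (\<lambda>k\<in>?K2. E k \<omega>)} = p2"
        unfolding p by (intro shift box) (auto simp: inj_def)
      show "Measurable.pred (PiM ?K1 (\<lambda>_. borel)) (?near ?left \<delta>\<^sub>1)"
        "Measurable.pred (PiM ?K2 (\<lambda>_. borel)) (?near ?right \<delta>\<^sub>2)"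
        by (intro one_sided_decodes_measurable comp; auto)+
      fix \<omega> assume \<omega>: "\<omega> \<in> space M"
      have near: "?near ?left \<delta>\<^sub>1 (\<lambda>k\<in>?K1. E k \<omega>) = ?near ?left \<delta>\<^sub>1 (\<lambda>k. E k \<omega>)"
        "?near ?right \<delta>\<^sub>2 (\<lambda>k\<in>?K2. E k \<omega>) = ?near ?right \<delta>\<^sub>2 (\<lambda>k. E k \<omega>)"
        by (intro one_sided_decodes_cong; auto)+
      assume "decodes l r t ((\<lambda>k\<in>{0}. E k \<omega>) 0) (flag_vec (?near ?left \<delta>\<^sub>1 (\<lambda>k\<in>?K1. E k \<omega>)))
          (flag_vec (?near ?right \<delta>\<^sub>2 (\<lambda>k\<in>?K2. E k \<omega>)))"
      then have dec: "decodes l r t (E 0 \<omega>) (flag_vec (?near ?left \<delta>\<^sub>1 (\<lambda>k. E k \<omega>)))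
          (flag_vec (?near ?right \<delta>\<^sub>2 (\<lambda>k. E k \<omega>)))"
        unfolding near by simp
      \<comment> \<open>In the chain, \<sigma> counts helpers from \<open>1\<close>, while the
        one-sided event counts from its own target at \<open>0\<close>; hence the shift to
        \<open>\<sigma> (Suc i)\<close>.\<close>
      have out: "box_le t (helper_chain l r t (Suc m) (\<lambda>i. E (\<sigma> i) \<omega>) \<delta>)
            (flag_vec (?near (\<lambda>i. \<sigma> (Suc i)) \<delta> (\<lambda>k. E k \<omega>)))"
          "unit_box t (helper_chain l r t (Suc m) (\<lambda>i. E (\<sigma> i) \<omega>) \<delta>)"
        if "unit_box t \<delta>" "\<And>i. i \<in> {1..Suc m} \<Longrightarrow> \<sigma> i \<in> ?I" for \<sigma> \<delta>
      proof -
        have E': "E (\<sigma> i) \<omega> \<in> {0..1}" if "i \<in> {1..Suc m}" for i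
          using E \<omega> \<open>i \<in> {1..Suc m} \<Longrightarrow> \<sigma> i \<in> ?I\<close>[OF that] by blast
        show "unit_box t (helper_chain l r t (Suc m) (\<lambda>i. E (\<sigma> i) \<omega>) \<delta>)"
          by (intro helper_chain_unit E' \<open>unit_box t \<delta>\<close>)
        have "unit_box t (helper_chain l r t m (\<lambda>i. E (\<sigma> (Suc i)) \<omega>) \<delta>)"
          by (intro helper_chain_unit E' \<open>unit_box t \<delta>\<close>) auto
        then show "box_le t (helper_chain l r t (Suc m) (\<lambda>i. E (\<sigma> i) \<omega>) \<delta>)
            (flag_vec (?near (\<lambda>i. \<sigma> (Suc i)) \<delta> (\<lambda>k. E k \<omega>)))"
          using helper_out_le_flag_vec[OF E'[of 1]]
          unfolding helper_chain_Suc_nearest one_sided_decodes_def by simp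
      qed
      show "two_sided_decodes l r t (Suc m) \<delta>\<^sub>1 \<delta>\<^sub>2 (\<lambda>k. E k \<omega>)"
        unfolding two_sided_decodes_def
        by (rule decodes_antimono[OF dec]) (intro out box unit_box_flag_vec; auto)+
    qed (auto simp: c_def intro!: two_Suc_sets decodes_measurable comp)
    also have "\<dots> = two_sided_success l r t M E j \<delta>\<^sub>1 \<delta>\<^sub>2"
      using two_eq[of j] box by (simp add: j2)
    finally have "p1 * p2 * c True True + p1 * (1 - p2) * c True False + (1 - p1) * p2 * c False True
        + (1 - p1) * (1 - p2) * c False False \<le> two_sided_success l r t M E j \<delta>\<^sub>1 \<delta>\<^sub>2" .
    \<comment> \<open>Here the third block is the target alone, so the mixed patterns already agree
      as events, by \<open>commute\<close>.\<close>
    moreover have "c True True = P_D" "c False True = P_S" "c True False = P_S" "c False False = P_L"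
      unfolding c_def assms(12-14) flag_vec_def using less_c[of 0] commute[of _ "\<lambda>_. 0" "\<lambda>_. 1"] by auto
    ultimately show ?thesis by (simp add: algebra_simps)
  qed
  show ?thesis
    unfolding j2 Let_def using farthest nearest[OF _ _ refl refl] by (auto simp: unit_box_def)
qed

end
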